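(* For all integers $n,m,d_A,d_B\ge 1$, \[ \sup_{\rho\in \mathrm{BEXT}_{n,m}(d_A,d_B)}\ \inf_{\sigma\in \mathrm{SEP}(d_A,d_B)}\ \tfrac12\|\rho-\sigma\|_1\ \le\ \frac12\sqrt{\frac{\min\{d_A,d_B\}-1}{nm}} . \]
   Context: $\mathrm D(\mathcal H)$ denotes the density operators on a finite-dimensional complex Hilbert space $\mathcal H$, and $\|\cdot\|_1$ is the trace norm. $\mathrm{Sym}^k(\mathcal H)\subseteq\mathcal H^{\otimes k}$ is the symmetric subspace. $\mathrm{SEP}(d_A,d_B):=\mathrm{conv}\{|u\rangle\langle u|\otimes|v\rangle\langle v|:u\in\mathbb C^{d_A},\ v\in\mathbb C^{d_B},\ \|u\|=\|v\|=1\}$. Label the tensor factors of $(\mathbb C^{d_A})^{\otimes n}\otimes(\mathbb C^{d_B})^{\otimes m}$ as $A_1,\dots,A_n,B_1,\dots,B_m$, and write $\widetilde\rho_{A_1B_1}$ for the marginal of a state $\widetilde\rho$ on $A_1B_1$. Then $\mathrm{BEXT}_{n,m}(d_A,d_B):=\{\widetilde\rho_{A_1B_1}:\widetilde\rho\in\mathrm D(\mathrm{Sym}^n(\mathbb C^{d_A})\otimes\mathrm{Sym}^m(\mathbb C^{d_B}))\}$ (Bose-symmetric $(n,m)$-extendible states), where $\widetilde\rho$ is regarded as a state on $(\mathbb C^{d_A})^{\otimes n}\otimes(\mathbb C^{d_B})^{\otimes m}$ supported on that subspace. *)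

theory Defs
  imports "HOL-Analysis.Analysis"
begin

(* Operators on the Hilbert space with orthonormal basis indexed by the finite type 'i. *)
type_synonym 'i operator = "complex^'i^'i"

definition cinner :: "complex^'i::finite \<Rightarrow> complex^'i \<Rightarrow> complex" where
  "cinner x y = (\<Sum>i\<in>UNIV. cnj (x $ i) * y $ i)"

definition adj :: "'i::finite operator \<Rightarrow> 'i operator" where
  "adj A = (\<chi> i j. cnj (A $ j $ i))"

definition psd :: "'i::finite operator \<Rightarrow> bool" where
  "psd A \<longleftrightarrow> adj A = A \<and> (\<forall>x. 0 \<le> Re (cinner x (A *v x)))"

definition density_operator :: "'i::finite operator \<Rightarrow> bool" where
  "density_operator \<rho> \<longleftrightarrow> psd \<rho> \<and> trace \<rho> = 1"

(* Only meaningful for psd A, where the positive semidefinite root exists and is unique. *)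
definition psd_sqrt :: "'i::finite operator \<Rightarrow> 'i operator" where
  "psd_sqrt A = (THE S. psd S \<and> S ** S = A)"

definition trace_norm :: "'i::finite operator \<Rightarrow> real" where
  "trace_norm X = Re (trace (psd_sqrt (adj X ** X)))"

definition rank_one :: "complex^'i::finite \<Rightarrow> 'i operator" where
  "rank_one u = (\<chi> i j. u $ i * cnj (u $ j))"

definition tensor_vec :: "complex^'i::finite \<Rightarrow> complex^'j::finite \<Rightarrow> complex^('i \<times> 'j)" where
  "tensor_vec u v = (\<chi> p. u $ fst p * v $ snd p)"

definition tensor_op :: "'i::finite operator \<Rightarrow> 'j::finite operator \<Rightarrow> ('i \<times> 'j) operator" where
  "tensor_op A B = (\<chi> p q. A $ fst p $ fst q * B $ snd p $ snd q)"

definition SEP :: "('a::finite \<times> 'b::finite) operator set" where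
  "SEP = convex hull {tensor_op (rank_one u) (rank_one v) | u v. norm u = 1 \<and> norm v = 1}"

(* The k-fold tensor power of C^d is complex^('k \<Rightarrow> 'a), where 'k is a type of k factor labels,
   'a indexes the basis of C^d, and the basis vector of index f is the tensor product, over the
   labels l, of the basis vectors of index f l.  A permutation of the factors acts by f \<mapsto> f \<circ> \<pi>. *)
definition sym_space :: "(complex^('k::finite \<Rightarrow> 'a::finite)) set" where
  "sym_space = {\<psi>. \<forall>\<pi> f. bij \<pi> \<longrightarrow> \<psi> $ (f \<circ> \<pi>) = \<psi> $ f}"

(* vec.span is the complex-linear span. *)
definition tensor_space ::
  "(complex^'i::finite) set \<Rightarrow> (complex^'j::finite) set \<Rightarrow> (complex^('i \<times> 'j)) set" where
  "tensor_space U V = vec.span {tensor_vec u v | u v. u \<in> U \<and> v \<in> V}"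

(* For a Hermitian operator the support is the range. *)
definition supported_on :: "'i::finite operator \<Rightarrow> (complex^'i) set \<Rightarrow> bool" where
  "supported_on \<rho> W \<longleftrightarrow> range (\<lambda>x. \<rho> *v x) \<subseteq> W"

(* Partial trace over all factors except the A-factor labelled i and the B-factor labelled j:
   f and g run over the basis indices that extend the row index p, and the column index has the
   same entries on all the factors that are traced out. *)
definition marginal ::
  "'n \<Rightarrow> 'm \<Rightarrow> (('n::finite \<Rightarrow> 'a::finite) \<times> ('m::finite \<Rightarrow> 'b::finite)) operator
    \<Rightarrow> ('a \<times> 'b) operator" where
  "marginal i j \<rho> = (\<chi> p q. \<Sum>f | f i = fst p. \<Sum>g | g j = snd p.
     \<rho> $ (f, g) $ (f(i := fst q), g(j := snd q)))"

(* The parameters n, m are the cardinalities of the label types 'n, 'm, and i, j are the labels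
   of the two factors called A_1, B_1. *)
definition BEXT :: "'n::finite \<Rightarrow> 'm::finite \<Rightarrow> ('a::finite \<times> 'b::finite) operator set" where
  "BEXT i j = {marginal i j \<rho> | \<rho> :: (('n \<Rightarrow> 'a) \<times> ('m \<Rightarrow> 'b)) operator.
     density_operator \<rho> \<and> supported_on \<rho> (tensor_space sym_space sym_space)}"

end

theory Submission
  imports Defs
begin

text \<open>By Hahn--Banach it suffices to bound, for each Hermitian \<open>Y\<close> of norm at most \<open>t\<close>, the value of \<open>Y\<close>
  on the marginal by its value on some product vector plus \<open>t \<delta>\<close>, where
  \<open>\<delta> = sqrt ((min d\<^sub>A d\<^sub>B - 1) / (n m))\<close>. Let \<open>\<psi>\<close> maximize the quadratic form of \<open>Y\<close> (acting on one pair of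
  factors) on the unit sphere of the symmetric subspace, with maximum \<open>\<lambda>\<close>, and choose unit vectors
  \<open>u\<close>, \<open>v\<close> that maximize the modulus of the overlap \<open>G\<close> of \<open>\<psi>\<close> with \<open>u\<^sup>n \<otimes> v\<^sup>m\<close>; it is nonzero by
  polarization. Contracting \<open>\<psi>\<close> with \<open>u\<close> and \<open>v\<close> on all but one pair of factors leaves \<open>G (u \<otimes> v + \<xi>)\<close>.
  The first-order conditions at the maximum say that \<open>\<xi>\<close>, as a matrix, annihilates \<open>u\<close> and \<open>v\<close>; the
  second-order condition for \<open>u + s x\<close>, \<open>v + t y\<close> bounds its operator norm by \<open>1 / sqrt (n m)\<close>. As its rank
  is at most \<open>min d\<^sub>A d\<^sub>B - 1\<close>, its Frobenius norm is at most \<open>\<delta>\<close>. Pairing the eigenvalue equation for \<open>\<psi>\<close>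
  with \<open>u\<^sup>n \<otimes> v\<^sup>m\<close> yields \<open>\<lambda> = \<langle>Y (u \<otimes> v), u \<otimes> v + \<xi>\<rangle>\<close>.\<close>

section \<open>Maximizing a quadratic form on the unit sphere of a subspace\<close>

text \<open>Serves both the spectral theorem and the symmetric subspace. In the second use
  \<open>L\<close> need not map \<open>U\<close> into itself, so the last conclusion is an
  eigenvalue equation tested only against \<open>U\<close>.\<close>

lemma rayleigh_maximizer:
  fixes U :: "'a::euclidean_space set"
  assumes U: "subspace U" "U \<noteq> {0}" and L: "linear L"
    and sym: "\<And>x y. x \<in> U \<Longrightarrow> y \<in> U \<Longrightarrow> x \<bullet> L y = L x \<bullet> y"
  obtains e l where "e \<in> U" "norm e = 1"
    "\<And>x. x \<in> U \<Longrightarrow> x \<bullet> L x \<le> l * (x \<bullet> x)"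
    "\<And>x. x \<in> U \<Longrightarrow> x \<bullet> L e = l * (x \<bullet> e)"
proof -
  have "compact (sphere 0 1 \<inter> U)"
    by (simp add: U closed_subspace compact_Int_closed)
  moreover have "sphere 0 1 \<inter> U \<noteq> {}"
  proof -
    obtain x where "x \<in> U" "x \<noteq> 0"
      using U subspace_0 by blast
    then have "(1 / norm x) *\<^sub>R x \<in> sphere 0 1 \<inter> U"
      using U by (simp add: subspace_scale)
    then show ?thesis by blast
  qed
  moreover have "continuous_on (sphere 0 1 \<inter> U) (\<lambda>x. x \<bullet> L x)"
    by (intro continuous_intros linear_continuous_on linear_conv_bounded_linear[THEN iffD1] L)
  ultimately obtain e where e: "e \<in> sphere 0 1 \<inter> U"
    and max: "\<And>y. y \<in> sphere 0 1 \<inter> U \<Longrightarrow> y \<bullet> L y \<le> e \<bullet> L e"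
    by (metis continuous_attains_sup)
  define l where "l = e \<bullet> L e"
  have ee: "e \<bullet> e = 1" "e \<in> U"
    using e by (auto simp: dot_square_norm)
  have le: "x \<bullet> L x \<le> l * (x \<bullet> x)" if "x \<in> U" for x
  proof (cases "x = 0")
    case False
    let ?y = "(1 / norm x) *\<^sub>R x"
    have "?y \<bullet> L ?y \<le> l"
      unfolding l_def using that False U by (intro max) (simp add: subspace_scale)
    moreover have "?y \<bullet> L ?y = (x \<bullet> L x) / (x \<bullet> x)"
      by (simp add: linear_scale[OF L] dot_square_norm power2_eq_square)
    ultimately have "x \<bullet> L x / (x \<bullet> x) \<le> l" by simp
    then show ?thesis
      using False by (simp add: divide_le_eq)
  qed simp
  have "x \<bullet> L e = l * (x \<bullet> e)" if x: "x \<in> U" for x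
  proof -
    define b where "b = l * (x \<bullet> e) - x \<bullet> L e"
    define c where "c = l * (x \<bullet> x) - x \<bullet> L x"
    \<comment> \<open>The slack of \<open>le\<close> at \<open>e + t x\<close>: a quadratic in
      \<open>t\<close> without constant term that is never negative, so its linear coefficient must
      vanish.\<close>
    have *: "0 \<le> 2 * t * b + t\<^sup>2 * c" for t
    proof -
      have "e + t *\<^sub>R x \<in> U"
        using U ee x by (simp add: subspace_add subspace_scale)
      from le[OF this] show ?thesis
        using sym[OF ee(2) x]
        by (simp add: linear_add[OF L] linear_scale[OF L] inner_add_left inner_add_right ee
            l_def[symmetric] b_def c_def algebra_simps power2_eq_square inner_commute)
    qed
    have "c \<ge> 0"
      using le[OF x] by (simp add: c_def)
    have "b = 0"
    proof (rule ccontr)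
      assume "b \<noteq> 0"
      obtain k where k: "k > 0" "c = k - 1"
        using \<open>c \<ge> 0\<close> by (metis add.commute add_diff_cancel_left' add_pos_nonneg zero_less_one)
      \<comment> \<open>The minimizer \<open>- b / c\<close> is replaced by
        \<open>- b / (c + 1)\<close>, which also covers \<open>c = 0\<close> and still gives a
        negative value.\<close>
      have "2 * (- b / (c + 1)) * b + (- b / (c + 1))\<^sup>2 * c = - (b\<^sup>2 * (c + 2) / (c + 1)\<^sup>2)"
        unfolding k(2) using k(1) by (simp add: field_simps power2_eq_square)
      moreover have "b\<^sup>2 * (c + 2) / (c + 1)\<^sup>2 > 0"
        using \<open>c \<ge> 0\<close> \<open>b \<noteq> 0\<close> by simp
      ultimately show False
        using *[of "- b / (c + 1)"] by linarith
    qed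
    then show ?thesis by (simp add: b_def)
  qed
  with le ee e that show thesis by auto
qed

subsection \<open>The Hermitian inner product and the spectral theorem\<close>

text \<open>The bridge between two structures: compactness, separation and Pythagoras use the real
  inner product, eigenvalue arguments the sesquilinear \<open>cinner\<close>.\<close>

lemma inner_eq_Re_cinner: "x \<bullet> y = Re (cinner x y)"
  by (simp add: cinner_def inner_vec_def inner_complex_def)

lemma cinner_add_right: "cinner x (y + z) = cinner x y + cinner x z"
  by (simp add: cinner_def algebra_simps sum.distrib)

lemma cinner_diff_right: "cinner x (y - z) = cinner x y - cinner x z"
  by (simp add: cinner_def algebra_simps sum_subtractf)

lemma cinner_scale_right: "cinner x (c *s y) = c * cinner x y"
  by (simp add: cinner_def algebra_simps sum_distrib_left)

lemma cinner_scale_left: "cinner (c *s x) y = cnj c * cinner x y"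
  by (simp add: cinner_def algebra_simps sum_distrib_left)

lemma cinner_sum_right: "cinner x (\<Sum>i\<in>I. f i) = (\<Sum>i\<in>I. cinner x (f i))"
  by (simp add: cinner_def sum_distrib_left) (rule sum.swap)

lemma cinner_commute: "cinner x y = cnj (cinner y x)"
  by (simp add: cinner_def mult.commute)

lemma cinner_self: "cinner x x = of_real ((norm x)\<^sup>2)"
proof -
  have "Im (cinner x x) = 0"
    by (simp add: cinner_def mult.commute)
  then show ?thesis
    by (simp add: complex_eq_iff flip: inner_eq_Re_cinner dot_square_norm)
qed

lemma cinner_adj: "cinner x (A *v y) = cinner (adj A *v x) y"
  unfolding cinner_def adj_def matrix_vector_mult_def
  by (simp add: sum_distrib_left sum_distrib_right mult.assoc mult.left_commute) (subst sum.swap, simp add: mult_ac)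

lemma scaleR_eq_of_real_smult: "r *\<^sub>R (x :: complex^'i) = of_real r *s x"
  unfolding vec_eq_iff vector_scaleR_component by (simp add: scaleR_conv_of_real)

lemma norm_smult_complex: "norm (c *s x) = cmod c * norm (x :: complex^'i::finite)"
  by (simp add: norm_vec_def L2_set_def norm_mult power_mult_distrib real_sqrt_mult
      flip: sum_distrib_left)

lemma complex_subspace_imp_subspace:
  "vec.subspace U \<Longrightarrow> subspace (U :: (complex^'i::finite) set)"
  by (simp add: subspace_def vec.subspace_def scaleR_eq_of_real_smult)

lemma linear_matrix_vector_mult_complex: "linear ((*v) (A :: complex^'i::finite^'j::finite))"
  by (rule linearI) (simp_all add: matrix_vector_right_distrib scaleR_eq_of_real_smult vec.scale)

text \<open>Testing against \<open>\<i> *s x\<close> as well as \<open>x\<close> recovers the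
  imaginary part.\<close>

lemma Re_cinner_eq_imp_eq:
  assumes "vec.subspace U" "x \<in> U"
    and "\<And>x. x \<in> U \<Longrightarrow> Re (cinner x y) = 0"
  shows "cinner x y = 0"
proof -
  have "\<i> *s x \<in> U"
    using assms by (simp add: vec.subspace_def)
  from assms(3)[OF this] assms(3)[OF assms(2)] show ?thesis
    by (simp add: cinner_scale_left complex_eq_iff)
qed

definition eigenbasis :: "'i::finite operator \<Rightarrow> (complex^'i) set \<Rightarrow> (complex^'i \<Rightarrow> real) \<Rightarrow> bool" where
  "eigenbasis A E l \<longleftrightarrow> finite E \<and> (\<forall>e\<in>E. norm e = 1 \<and> A *v e = of_real (l e) *s e) \<and>
     pairwise (\<lambda>e f. cinner e f = 0) E \<and> (\<forall>x. x = (\<Sum>e\<in>E. cinner e x *s e))"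

text \<open>The orthogonal complement \<open>U\<close> of the eigenvectors found so far is invariant
  under the Hermitian \<open>A\<close>. If they fail to span, \<open>U\<close> is nonzero and
  contains a Rayleigh maximizer, which invariance makes a genuine eigenvector.\<close>

lemma eigenvectors_extend:
  fixes A :: "'i::finite operator"
  assumes A: "adj A = A" and fin: "finite E"
    and nE: "\<And>e. e \<in> E \<Longrightarrow> norm e = 1" and eE: "\<And>e. e \<in> E \<Longrightarrow> A *v e = of_real (l e) *s e"
    and pE: "pairwise (\<lambda>e f. cinner e f = 0) E"
    and x: "x \<noteq> (\<Sum>e\<in>E. cinner e x *s e)"
  obtains f r where "norm f = 1" "A *v f = of_real r *s f" "\<And>e. e \<in> E \<Longrightarrow> cinner e f = 0"
proof -
  define U where "U = {y. \<forall>e\<in>E. cinner e y = 0}"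
  have cU: "vec.subspace U"
    by (auto simp: U_def vec.subspace_def cinner_add_right cinner_scale_right)
      (simp add: cinner_def)
  have "x - (\<Sum>e\<in>E. cinner e x *s e) \<in> U"
  proof -
    have "(\<Sum>f\<in>E. cinner f x * cinner e f) = cinner e x" if "e \<in> E" for e
    proof -
      have "(\<Sum>f\<in>E. cinner f x * cinner e f) = (\<Sum>f\<in>E. if f = e then cinner e x else 0)"
        using that pE nE by (intro sum.cong) (auto simp: pairwise_def cinner_self)
      with that fin show ?thesis by simp
    qed
    then show ?thesis
      by (simp add: U_def cinner_diff_right cinner_sum_right cinner_scale_right)
  qed
  with x have ne: "U \<noteq> {0}"
    by (metis right_minus_eq singletonD)
  have AU: "A *v y \<in> U" if "y \<in> U" for y
    using that eE by (auto simp: U_def cinner_adj A cinner_scale_left)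
  have sym: "x \<bullet> (A *v y) = (A *v x) \<bullet> y" for x y
    by (simp add: inner_eq_Re_cinner cinner_adj A)
  obtain f r where f: "f \<in> U" "norm f = 1"
    and r: "\<And>x. x \<in> U \<Longrightarrow> x \<bullet> (A *v f) = r * (x \<bullet> f)"
    using rayleigh_maximizer[OF complex_subspace_imp_subspace[OF cU] ne linear_matrix_vector_mult_complex sym]
    by metis
  let ?z = "A *v f - r *\<^sub>R f"
  have "?z \<in> U"
    using f AU cU by (simp add: complex_subspace_imp_subspace subspace_diff subspace_scale)
  from r[OF this] have "?z \<bullet> ?z = 0"
    by (simp add: inner_diff_right)
  then have "A *v f = of_real r *s f"
    by (simp add: scaleR_eq_of_real_smult)
  with f that show thesis
    by (auto simp: U_def)
qed

text \<open>The dimension bounds the size of an orthonormal set of eigenvectors, so one of maximal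
  size exists; by \<open>eigenvectors_extend\<close> it is complete.\<close>

lemma hermitian_eigenbasis:
  fixes A :: "'i::finite operator"
  assumes A: "adj A = A"
  obtains E l where "eigenbasis A E l"
proof -
  define P where "P E \<longleftrightarrow> finite E \<and> pairwise (\<lambda>e f. cinner e f = 0) E \<and>
    (\<forall>e\<in>E. norm e = 1 \<and> (\<exists>r::real. A *v e = of_real r *s e))" for E :: "(complex^'i) set"
  have bound: "card E \<le> DIM(complex^'i)" if "P E" for E
  proof -
    have "pairwise orthogonal E"
      using that by (auto simp: P_def pairwise_def orthogonal_def inner_eq_Re_cinner)
    moreover have "0 \<notin> E"
      using that by (auto simp: P_def)
    ultimately show ?thesis
      using independent_bound pairwise_orthogonal_independent by blast
  qed
  have "P {}"
    by (simp add: P_def)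
  with bound obtain E where E: "P E" and max: "\<And>F. P F \<Longrightarrow> card F \<le> card E"
    using ex_has_greatest_nat[of P "{}" card "Suc DIM(complex^'i)"] by (metis le_imp_less_Suc)
  obtain l :: "complex^'i \<Rightarrow> real" where l: "\<And>e. e \<in> E \<Longrightarrow> A *v e = of_real (l e) *s e"
    using E unfolding P_def by metis
  have "x = (\<Sum>e\<in>E. cinner e x *s e)" for x
  proof (rule ccontr)
    assume x: "x \<noteq> (\<Sum>e\<in>E. cinner e x *s e)"
    obtain f r where f: "norm f = 1" "A *v f = of_real r *s f" "\<And>e. e \<in> E \<Longrightarrow> cinner e f = 0"
      using eigenvectors_extend[OF A _ _ l _ x] E unfolding P_def by blast
    have "cinner f e = 0" if "e \<in> E" for e
      using f(3)[OF that] cinner_commute[of f e] by simp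
    with f E have "P (insert f E)"
      unfolding P_def by (auto simp: pairwise_insert)
    moreover have "f \<notin> E"
      using f(1) f(3)[of f] by (auto simp: cinner_self)
    ultimately show False
      using max[of "insert f E"] E by (auto simp: P_def)
  qed
  with E l have "eigenbasis A E l"
    unfolding P_def eigenbasis_def by simp
  then show thesis by (rule that)
qed

lemma eigenbasisD:
  assumes "eigenbasis A E l"
  shows "finite E" "e \<in> E \<Longrightarrow> norm e = 1" "e \<in> E \<Longrightarrow> A *v e = of_real (l e) *s e"
    "e \<in> E \<Longrightarrow> f \<in> E \<Longrightarrow> cinner e f = (if e = f then 1 else 0)"
    "x = (\<Sum>e\<in>E. cinner e x *s e)"
  using assms by (auto simp: eigenbasis_def pairwise_def cinner_self)

text \<open>Functional calculus on a fixed eigenbasis: suitable choices of \<open>g\<close> give the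
  operator itself, its square, its modulus and its sign.\<close>

definition spectral_op :: "(complex^'i::finite) set \<Rightarrow> (complex^'i \<Rightarrow> real) \<Rightarrow> 'i operator" where
  "spectral_op E g = (\<Sum>e\<in>E. g e *\<^sub>R rank_one e)"

lemma spectral_op_component:
  "spectral_op E g $ i $ j = (\<Sum>e\<in>E. of_real (g e) * (e $ i * cnj (e $ j)))"
  unfolding spectral_op_def rank_one_def sum_component vector_scaleR_component
  by (simp add: scaleR_conv_of_real)

lemma spectral_op_mult_vec: "spectral_op E g *v x = (\<Sum>e\<in>E. (of_real (g e) * cinner e x) *s e)"
  unfolding vec_eq_iff matrix_vector_mult_def spectral_op_component cinner_def
  by (simp add: sum_distrib_left sum_distrib_right mult_ac) (subst sum.swap, simp)

lemma adj_spectral_op: "adj (spectral_op E g) = spectral_op E g"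
  unfolding vec_eq_iff adj_def spectral_op_component by (simp add: mult_ac)

lemma cinner_spectral_op: "cinner x (spectral_op E g *v x) = (\<Sum>e\<in>E. of_real (g e * (cmod (cinner e x))\<^sup>2))"
  unfolding spectral_op_mult_vec cinner_sum_right cinner_scale_right
  by (rule sum.cong) (simp_all add: cinner_commute[of x] mult.assoc flip: complex_norm_square of_real_power)

lemma inner_spectral_op: "x \<bullet> (spectral_op E g *v x) = (\<Sum>e\<in>E. g e * (cmod (cinner e x))\<^sup>2)"
  unfolding inner_eq_Re_cinner cinner_spectral_op by simp

lemma psd_spectral_op: "(\<And>e. e \<in> E \<Longrightarrow> 0 \<le> g e) \<Longrightarrow> psd (spectral_op E g)"
  by (simp add: psd_def adj_spectral_op inner_spectral_op sum_nonneg flip: inner_eq_Re_cinner)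

text \<open>On operators the real inner product is the real part of the Hilbert-Schmidt product, so
  linear functionals can be read as observables.\<close>

lemma inner_rank_one: "W \<bullet> rank_one x = x \<bullet> (W *v x)"
  unfolding inner_vec_def rank_one_def matrix_vector_mult_def
  by (simp add: inner_complex_def sum_distrib_left sum_subtractf algebra_simps flip: sum.distrib)

context
  fixes A :: "'i::finite operator" and E l
  assumes E: "eigenbasis A E l"
begin

lemma spectral_op_eigenvector: "e \<in> E \<Longrightarrow> spectral_op E g *v e = of_real (g e) *s e"
proof -
  assume e: "e \<in> E"
  have "spectral_op E g *v e = (\<Sum>f\<in>E. if f = e then of_real (g e) *s e else 0)"
    unfolding spectral_op_mult_vec using e eigenbasisD(4)[OF E] by (intro sum.cong) auto
  then show ?thesis
    using e eigenbasisD(1)[OF E] by simp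
qed

lemma operator_eqI:
  assumes "\<And>e. e \<in> E \<Longrightarrow> B *v e = C *v e"
  shows "B = (C :: 'i operator)"
proof -
  have "B *v x = C *v x" for x
  proof -
    have "B *v (\<Sum>e\<in>E. cinner e x *s e) = C *v (\<Sum>e\<in>E. cinner e x *s e)"
      by (simp add: vec.linear_sum[OF matrix_vector_mul_linear_gen] vec.scale assms)
    then show ?thesis
      using eigenbasisD(5)[OF E, of x] by simp
  qed
  then show ?thesis by (simp add: matrix_eq)
qed

lemma spectral_decomposition: "A = spectral_op E l"
  by (rule operator_eqI) (simp add: spectral_op_eigenvector eigenbasisD(3)[OF E])

lemma spectral_op_mult: "spectral_op E g ** spectral_op E h = spectral_op E (\<lambda>e. g e * h e)"
  by (rule operator_eqI)
    (simp add: spectral_op_eigenvector vec.scale vector_smult_assoc mult_ac flip: matrix_vector_mul_assoc)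

lemma trace_spectral_op: "trace (spectral_op E g) = of_real (\<Sum>e\<in>E. g e)"
proof -
  have "trace (spectral_op E g) = (\<Sum>e\<in>E. of_real (g e) * cinner e e)"
    unfolding trace_def spectral_op_component cinner_def sum_distrib_left
    by (subst sum.swap) (simp add: mult_ac)
  then show ?thesis
    by (simp add: eigenbasisD(4)[OF E])
qed

lemma parseval: "(\<Sum>e\<in>E. (cmod (cinner e x))\<^sup>2) = x \<bullet> x"
proof -
  have "spectral_op E (\<lambda>_. 1) = mat 1"
    by (rule operator_eqI) (simp add: spectral_op_eigenvector)
  then show ?thesis
    using inner_spectral_op[of x E "\<lambda>_. 1"] by simp
qed

end

section \<open>Square roots and trace-norm duality\<close>

text \<open>The description in \<open>psd_sqrt\<close> calls for uniqueness. For another root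
  \<open>T\<close> and an eigenvector \<open>e\<close>, the vector \<open>y = T e - g e\<close>
  satisfies \<open>T y = - g y\<close>, so positivity of \<open>T\<close> forces
  \<open>y = 0\<close> if \<open>g e > 0\<close>. If \<open>g e = 0\<close>, the square of
  \<open>T\<close> kills \<open>e\<close>, hence so does the Hermitian \<open>T\<close>.\<close>

lemma psd_sqrt_spectral_op:
  assumes E: "eigenbasis A E l" and g: "\<And>e. e \<in> E \<Longrightarrow> 0 \<le> g e"
  shows "psd_sqrt (spectral_op E (\<lambda>e. g e * g e)) = spectral_op E g"
  unfolding psd_sqrt_def
proof (rule the_equality)
  show "psd (spectral_op E g) \<and> spectral_op E g ** spectral_op E g = spectral_op E (\<lambda>e. g e * g e)"
    by (simp add: psd_spectral_op g spectral_op_mult[OF E])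
next
  fix T :: "'a operator"
  assume T: "psd T \<and> T ** T = spectral_op E (\<lambda>e. g e * g e)"
  have adjT: "adj T = T"
    using T by (simp add: psd_def)
  have TT: "T *v (T *v e) = of_real (g e * g e) *s e" if "e \<in> E" for e
    unfolding matrix_vector_mul_assoc T[THEN conjunct2] by (rule spectral_op_eigenvector[OF E that])
  show "T = spectral_op E g"
  proof (rule operator_eqI[OF E])
    fix e assume e: "e \<in> E"
    define y where "y = T *v e - of_real (g e) *s e"
    have y: "T *v y = - (of_real (g e) *s y)"
      unfolding y_def matrix_vector_mult_diff_distrib vector_scalar_commute TT[OF e]
      by (simp add: vec_eq_iff algebra_simps)
    have "y = 0"
    proof (cases "g e = 0")
      case True
      then have "cinner e (T *v (T *v e)) = 0"
        using TT[OF e] by (simp add: cinner_def)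
      then have "T *v e = 0"
        by (simp add: cinner_adj adjT cinner_self)
      with True show ?thesis by (simp add: y_def)
    next
      case False
      have "0 \<le> y \<bullet> (T *v y)"
        using T by (simp add: psd_def inner_eq_Re_cinner)
      also have "\<dots> = - (g e * (y \<bullet> y))"
        unfolding y by (simp flip: scaleR_eq_of_real_smult)
      finally show ?thesis
        using False g[OF e] by (auto simp: mult_le_0_iff dot_square_norm)
    qed
    then show "T *v e = spectral_op E g *v e"
      by (simp add: y_def spectral_op_eigenvector[OF E e])
  qed
qed

text \<open>The operator sign of \<open>X\<close> serves as \<open>W\<close>; its pairing with
  \<open>X\<close> is the sum of the absolute eigenvalues.\<close>

lemma trace_norm_hermitian_dual:
  fixes X :: "'i::finite operator"
  assumes X: "adj X = X"
  obtains W where "\<And>x. \<bar>x \<bullet> (W *v x)\<bar> \<le> x \<bullet> x" "trace_norm X = W \<bullet> X"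
proof -
  obtain E l where E: "eigenbasis X E l"
    using hermitian_eigenbasis[OF X] .
  note XE = spectral_decomposition[OF E]
  \<comment> \<open>Written with absolute values to exhibit the nonnegative root that
    \<open>psd_sqrt_spectral_op\<close> expects.\<close>
  have "adj X ** X = spectral_op E (\<lambda>e. \<bar>l e\<bar> * \<bar>l e\<bar>)"
    unfolding X by (subst (1 2) XE) (simp add: spectral_op_mult[OF E])
  then have tn: "trace_norm X = (\<Sum>e\<in>E. \<bar>l e\<bar>)"
    unfolding trace_norm_def by (simp add: psd_sqrt_spectral_op[OF E] trace_spectral_op[OF E] del: abs_mult_self_eq)
  define W where "W = spectral_op E (\<lambda>e. sgn (l e))"
  have "W \<bullet> X = (\<Sum>e\<in>E. l e * (e \<bullet> (W *v e)))"
    by (subst XE) (simp add: spectral_op_def inner_sum_right inner_rank_one)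
  also have "\<dots> = (\<Sum>e\<in>E. \<bar>l e\<bar>)"
    by (rule sum.cong)
      (simp_all add: W_def spectral_op_eigenvector[OF E] eigenbasisD(2)[OF E] dot_square_norm abs_sgn mult.commute
        flip: scaleR_eq_of_real_smult)
  finally have "trace_norm X = W \<bullet> X"
    using tn by simp
  moreover have "\<bar>x \<bullet> (W *v x)\<bar> \<le> x \<bullet> x" for x
  proof -
    have "\<bar>x \<bullet> (W *v x)\<bar> \<le> (\<Sum>e\<in>E. \<bar>sgn (l e) * (cmod (cinner e x))\<^sup>2\<bar>)"
      unfolding W_def inner_spectral_op by (rule sum_abs)
    also have "\<dots> \<le> (\<Sum>e\<in>E. (cmod (cinner e x))\<^sup>2)"
      by (intro sum_mono) (simp add: abs_mult abs_sgn_eq)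
    finally show ?thesis
      using parseval[OF E] by simp
  qed
  ultimately show thesis
    using that by blast
qed

subsection \<open>Separable operators and the trace norm\<close>

lemma continuous_on_vec_lambda [continuous_intros]:
  "(\<And>i. continuous_on S (\<lambda>x. f x i)) \<Longrightarrow> continuous_on S (\<lambda>x. \<chi> i. f x i)"
  unfolding continuous_on_def by (auto intro!: tendsto_vec_lambda)

lemma tensor_op_rank_one: "tensor_op (rank_one u) (rank_one v) = rank_one (tensor_vec u v)"
  by (simp add: vec_eq_iff tensor_op_def rank_one_def tensor_vec_def mult_ac)

lemma adj_rank_one: "adj (rank_one x) = rank_one x"
  by (simp add: vec_eq_iff adj_def rank_one_def mult_ac)

text \<open>The generators are a continuous image of a product of two spheres, and convex hulls of
  compact sets are compact in finite dimension.\<close>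

lemma compact_SEP: "compact (SEP :: ('a::finite \<times> 'b::finite) operator set)"
proof -
  have "{tensor_op (rank_one u) (rank_one v) | u v. norm u = 1 \<and> norm v = 1}
      = (\<lambda>(u :: complex^'a, v :: complex^'b). rank_one (tensor_vec u v)) ` (sphere 0 1 \<times> sphere 0 1)"
    unfolding tensor_op_rank_one by force
  moreover have "compact \<dots>"
    unfolding case_prod_unfold rank_one_def tensor_vec_def
    by (intro compact_continuous_image continuous_intros compact_Times compact_sphere)
  ultimately show ?thesis
    unfolding SEP_def by (simp add: compact_convex_hull)
qed

lemma rank_one_tensor_in_SEP: "norm u = 1 \<Longrightarrow> norm v = 1 \<Longrightarrow> rank_one (tensor_vec u v) \<in> SEP"
  unfolding SEP_def by (rule hull_inc) (auto simp flip: tensor_op_rank_one)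

lemma SEP_nonempty: "SEP \<noteq> {}"
  by (metis empty_iff rank_one_tensor_in_SEP vector_choose_size zero_le_one)

lemma linear_adj: "linear adj"
  by (rule linearI) (simp_all add: vec_eq_iff adj_def)

lemma adj_SEP:
  assumes "\<sigma> \<in> SEP"
  shows "adj \<sigma> = \<sigma>"
proof -
  have "SEP \<subseteq> {X. adj X = X}"
    unfolding SEP_def
  proof (rule hull_minimal)
    show "convex {X. adj X = X}"
      by (auto simp: convex_def linear_add[OF linear_adj] linear_scale[OF linear_adj])
  qed (auto simp: tensor_op_rank_one adj_rank_one)
  with assms show ?thesis by blast
qed

lemma inner_adj: "adj X \<bullet> adj Y = X \<bullet> Y"
  unfolding inner_vec_def adj_def by (simp add: inner_complex_def) (subst sum.swap, simp)

lemma hermitian_inner: "adj A = A \<Longrightarrow> x \<bullet> (A *v y) = (A *v x) \<bullet> y"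
  by (simp add: inner_eq_Re_cinner cinner_adj)

text \<open>Polarization at \<open>x + c y\<close> and \<open>x - c y\<close> with
  \<open>y = Y x\<close>, where \<open>c\<close> is chosen so that \<open>c y\<close> is as long as
  \<open>x\<close>.\<close>

lemma norm_le_of_numerical_radius:
  fixes Y :: "'i::finite operator"
  assumes Y: "adj Y = Y" and t: "\<And>x. \<bar>x \<bullet> (Y *v x)\<bar> \<le> t * (x \<bullet> x)"
  shows "norm (Y *v x) \<le> t * norm x"
proof (cases "Y *v x = 0 \<or> x = 0")
  case True
  have "0 \<le> t * norm x"
  proof (cases "x = 0")
    case False
    have "0 \<le> t * (x \<bullet> x)"
      using t[of x] by linarith
    with False show ?thesis by (simp add: zero_le_mult_iff dot_square_norm)
  qed simp
  with True show ?thesis by auto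
next
  case False
  define y where "y = Y *v x"
  define c where "c = norm x / norm y"
  have c: "c * norm y = norm x"
    using False by (simp add: c_def y_def)
  have "4 * c * (y \<bullet> y) = 2 * (c *\<^sub>R y \<bullet> (Y *v x)) + 2 * (x \<bullet> (Y *v (c *\<^sub>R y)))"
    using hermitian_inner[OF Y, of x "c *\<^sub>R y"] by (simp add: y_def inner_commute)
  also have "\<dots> = (x + c *\<^sub>R y) \<bullet> (Y *v (x + c *\<^sub>R y)) - (x - c *\<^sub>R y) \<bullet> (Y *v (x - c *\<^sub>R y))"
    unfolding matrix_vector_right_distrib matrix_vector_mult_diff_distrib
      inner_add_left inner_add_right inner_diff_left inner_diff_right by linarith
  also have "\<dots> \<le> t * ((x + c *\<^sub>R y) \<bullet> (x + c *\<^sub>R y)) + t * ((x - c *\<^sub>R y) \<bullet> (x - c *\<^sub>R y))"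
    using t[of "x + c *\<^sub>R y"] t[of "x - c *\<^sub>R y"] by linarith
  also have "\<dots> = 2 * t * ((norm x)\<^sup>2 + (c * norm y)\<^sup>2)"
    unfolding inner_add_left inner_add_right inner_diff_left inner_diff_right
    by (simp add: dot_square_norm power_mult_distrib power2_eq_square algebra_simps)
  finally have "c * (norm y * norm y) \<le> t * (norm x * norm x)"
    unfolding c by (simp add: dot_square_norm power2_eq_square)
  moreover have "c * (norm y * norm y) = norm y * norm x"
    by (metis c(1) mult.commute mult.left_commute)
  ultimately have "norm y * norm x \<le> (t * norm x) * norm x"
    by simp
  then show ?thesis
    using False by (simp add: y_def)
qed

text \<open>Hahn--Banach: the trace-norm ball is the polar of the operators of numerical radius at most
  \<open>1\<close>, so it suffices to beat each Hermitian observable separately.\<close>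

lemma separable_approximation:
  fixes \<rho> :: "('a::finite \<times> 'b::finite) operator"
  assumes \<rho>: "adj \<rho> = \<rho>" and \<delta>: "\<delta> > 0"
    and wit: "\<And>Y t. adj Y = Y \<Longrightarrow> (\<And>x. norm (Y *v x) \<le> t * norm x) \<Longrightarrow>
      \<exists>u v. norm u = 1 \<and> norm v = 1 \<and>
        Y \<bullet> \<rho> \<le> tensor_vec u v \<bullet> (Y *v tensor_vec u v) + t * \<delta>"
  obtains \<sigma> where "\<sigma> \<in> SEP" "trace_norm (\<rho> - \<sigma>) \<le> \<delta>"
proof -
  \<comment> \<open>Defined by duality rather than by \<open>trace_norm\<close>, so that it is
    visibly an intersection of closed half-spaces; its Hermitian members have trace norm at most
    \<open>\<delta>\<close>.\<close>
  define B :: "('a \<times> 'b) operator set" where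
    "B = {X. \<forall>W. (\<forall>x. \<bar>x \<bullet> (W *v x)\<bar> \<le> x \<bullet> x) \<longrightarrow> W \<bullet> X \<le> \<delta>}"
  define S where "S = (\<lambda>\<sigma>. \<rho> - \<sigma>) ` (SEP :: ('a \<times> 'b) operator set)"
  have B: "B = (\<Inter>W\<in>{W. \<forall>x. \<bar>x \<bullet> (W *v x)\<bar> \<le> x \<bullet> x}. {X. W \<bullet> X \<le> \<delta>})"
    by (auto simp: B_def)
  have "S \<inter> B \<noteq> {}"
  proof
    assume disj: "S \<inter> B = {}"
    have "convex S"
      unfolding S_def SEP_def
      using convex_translation[OF convex_negations[OF convex_convex_hull], of \<rho>]
      by (simp add: image_image)
    moreover have "compact S"
      unfolding S_def by (intro compact_continuous_image continuous_intros compact_SEP)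
    moreover have "S \<noteq> {}"
      by (simp add: S_def SEP_nonempty)
    moreover have "convex B" "closed B"
      unfolding B by (intro convex_INT ballI convex_halfspace_le closed_INT closed_halfspace_le)+
    ultimately obtain a b where a: "\<And>X. X \<in> S \<Longrightarrow> a \<bullet> X < b" "\<And>X. X \<in> B \<Longrightarrow> a \<bullet> X > b"
      using separating_hyperplane_compact_closed[of S B] disj by blast
    \<comment> \<open>The separating functional \<open>a\<close> is arbitrary; minus its Hermitian
      part pairs with Hermitian operators as \<open>- a\<close> does.\<close>
    define Y where "Y = - ((1/2) *\<^sub>R (a + adj a))"
    have adjadj: "adj (adj X) = X" for X :: "('a \<times> 'b) operator"
      by (simp add: vec_eq_iff adj_def)
    have adjY: "adj Y = Y"
      by (simp add: Y_def linear_neg[OF linear_adj] linear_add[OF linear_adj] linear_scale[OF linear_adj]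
          adjadj add.commute)
    have YX: "Y \<bullet> X = - (a \<bullet> X)" if "adj X = X" for X
      using inner_adj[of a X] that by (simp add: Y_def inner_add_left)
    have "0 \<in> B"
      using \<delta> by (simp add: B_def)
    with a(2)[of 0] have b: "b < 0" by simp
    \<comment> \<open>Chosen so that \<open>t * \<delta> = - b\<close>. The separation inequality on
      \<open>B\<close>, tested on the operators \<open>?X\<close> with \<open>c = 1\<close> and
      \<open>c = -1\<close>, then bounds the quadratic form of \<open>Y\<close> by
      \<open>t\<close>.\<close>
    define t where "t = - b / \<delta>"
    have "\<bar>x \<bullet> (Y *v x)\<bar> \<le> t * (x \<bullet> x)" for x
    proof (cases "x = 0")
      case False
      have *: "c * (x \<bullet> (Y *v x)) \<le> t * (x \<bullet> x)" if "\<bar>c\<bar> = 1" for c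
      proof -
        let ?X = "(c * \<delta> / (x \<bullet> x)) *\<^sub>R rank_one x"
        have "?X \<in> B"
          unfolding B_def
        proof (safe)
          fix W :: "('a \<times> 'b) operator"
          assume "\<forall>x. \<bar>x \<bullet> (W *v x)\<bar> \<le> x \<bullet> x"
          then have "c * (x \<bullet> (W *v x)) \<le> x \<bullet> x"
            using that by (metis abs_le_D1 abs_mult mult_1)
          then show "W \<bullet> ?X \<le> \<delta>"
            using False \<delta> by (simp add: inner_rank_one field_simps)
        qed
        from a(2)[OF this] have "Y \<bullet> ?X < - b"
          by (subst YX) (simp_all add: linear_scale[OF linear_adj] adj_rank_one)
        then show ?thesis
          using False \<delta> by (simp add: inner_rank_one t_def field_simps)
      qed
      from *[of 1] *[of "-1"] show ?thesis by simp
    qed simp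
    from wit[OF adjY norm_le_of_numerical_radius[OF adjY this]]
    obtain u v where uv: "norm u = 1" "norm v = 1"
      "Y \<bullet> \<rho> \<le> tensor_vec u v \<bullet> (Y *v tensor_vec u v) + t * \<delta>"
      by blast
    \<comment> \<open>Separation puts the value of \<open>Y\<close> on this difference strictly
      above \<open>t * \<delta>\<close>, whereas the witness keeps it at most
      \<open>t * \<delta>\<close>.\<close>
    have "a \<bullet> (\<rho> - rank_one (tensor_vec u v)) < b"
      using uv by (intro a) (auto simp: S_def rank_one_tensor_in_SEP)
    moreover have "Y \<bullet> (\<rho> - rank_one (tensor_vec u v)) = - (a \<bullet> (\<rho> - rank_one (tensor_vec u v)))"
      by (rule YX) (simp add: linear_diff[OF linear_adj] \<rho> adj_rank_one)
    ultimately show False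
      using uv(3) \<delta> by (simp add: inner_diff_right inner_rank_one t_def)
  qed
  then obtain \<sigma> where \<sigma>: "\<sigma> \<in> SEP" "\<rho> - \<sigma> \<in> B"
    by (auto simp: S_def)
  obtain W where "\<And>x. \<bar>x \<bullet> (W *v x)\<bar> \<le> x \<bullet> x" "trace_norm (\<rho> - \<sigma>) = W \<bullet> (\<rho> - \<sigma>)"
    using trace_norm_hermitian_dual[of "\<rho> - \<sigma>"] \<rho> adj_SEP[OF \<sigma>(1)]
    by (metis linear_diff[OF linear_adj])
  with \<sigma> that show thesis
    by (simp add: B_def)
qed

subsection \<open>Symmetric tensors\<close>

text \<open>Toggling a fixed \<open>k\<close> outside \<open>R\<close> pairs the supersets of
  \<open>R\<close> with opposite signs.\<close>

lemma sum_alternating_supersets_eq_0: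
  fixes R :: "'k::finite set"
  assumes "R \<noteq> UNIV"
  shows "(\<Sum>T | R \<subseteq> T. (-1) ^ card T :: complex) = 0"
proof -
  obtain k where k: "k \<notin> R"
    using assms by auto
  define tog where "tog T = (if k \<in> T then T - {k} else insert k T)" for T
  have tog: "tog (tog T) = T" "R \<subseteq> tog T \<longleftrightarrow> R \<subseteq> T" for T
    using k by (auto simp: tog_def)
  have card_tog: "(-1) ^ card (tog T) = - ((-1) ^ card T :: complex)" for T
  proof (cases "k \<in> T")
    case True
    then have "card T = Suc (card (T - {k}))"
      by (metis card_Suc_Diff1 finite)
    with True show ?thesis
      by (simp add: tog_def del: card_Diff_singleton card_Diff_insert)
  qed (simp add: tog_def)
  have "(\<Sum>T | R \<subseteq> T. (-1) ^ card T :: complex) = (\<Sum>T | R \<subseteq> T. - ((-1) ^ card T))"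
    by (rule sum.reindex_bij_witness[of _ tog tog]) (simp_all add: tog card_tog)
  then show ?thesis
    by (simp add: sum_negf)
qed

text \<open>Polarization, with \<open>u\<close> ranging over the sums of basis vectors \<open>g t\<close>, \<open>t \<in> T\<close>.\<close>

lemma symmetric_form_eq_0:
  fixes c :: "('k::finite \<Rightarrow> 'a::finite) \<Rightarrow> complex"
  assumes sym: "\<And>\<pi> f. bij \<pi> \<Longrightarrow> c (f \<circ> \<pi>) = c f"
    and zero: "\<And>u :: complex^'a. (\<Sum>f\<in>UNIV. c f * (\<Prod>l\<in>UNIV. u $ f l)) = 0"
  shows "c g = 0"
proof -
  have T0: "(\<Sum>s | range s \<subseteq> T. c (g \<circ> s)) = 0" for T
  proof -
    define u :: "complex^'a" where "u = (\<chi> a. \<Sum>t\<in>T. of_bool (g t = a))"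
    have PiE: "PiE UNIV (\<lambda>_::'k. T) = {s. range s \<subseteq> T}"
      by (auto simp: PiE_UNIV_domain)
    have prod_u: "(\<Prod>l\<in>UNIV. u $ f l) = (\<Sum>s | range s \<subseteq> T. of_bool (g \<circ> s = f))" for f :: "'k \<Rightarrow> 'a"
    proof -
      have "(\<Prod>l\<in>UNIV. u $ f l) = (\<Sum>s | range s \<subseteq> T. \<Prod>l\<in>UNIV. of_bool (g (s l) = f l))"
        unfolding u_def PiE[symmetric] vec_lambda_beta by (rule prod_sum_PiE) simp_all
      moreover have "(\<Prod>l\<in>UNIV. of_bool (g (s l) = f l) :: complex) = of_bool (g \<circ> s = f)" for s
        by (auto simp: fun_eq_iff)
      ultimately show ?thesis by simp
    qed
    have "(\<Sum>f\<in>UNIV. \<Sum>s | range s \<subseteq> T. c f * of_bool (g \<circ> s = f)) = 0"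
      using zero[of u] by (simp add: prod_u sum_distrib_left del: sum_of_bool_eq sum_mult_of_bool_eq)
    then have "(\<Sum>s | range s \<subseteq> T. \<Sum>f\<in>UNIV. c f * of_bool (g \<circ> s = f)) = 0"
      by (subst sum.swap)
    then show ?thesis by simp
  qed
  \<comment> \<open>Inclusion-exclusion over \<open>T\<close> keeps only the surjective
    \<open>s\<close>. On a finite set these are the permutations, and by symmetry each contributes
    \<open>c g\<close> with the same sign.\<close>
  have "0 = (\<Sum>T\<in>UNIV. (-1) ^ card T * (\<Sum>s | range s \<subseteq> T. c (g \<circ> s)))"
    by (simp add: T0)
  also have "\<dots> = (\<Sum>T\<in>UNIV. \<Sum>s\<in>UNIV. if range s \<subseteq> T then (-1) ^ card T * c (g \<circ> s) else 0)"
    by (simp add: sum_distrib_left flip: sum.inter_filter)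
  also have "\<dots> = (\<Sum>s\<in>UNIV. \<Sum>T\<in>UNIV. if range s \<subseteq> T then (-1) ^ card T * c (g \<circ> s) else 0)"
    by (rule sum.swap)
  also have "\<dots> = (\<Sum>s\<in>UNIV. (\<Sum>T | range s \<subseteq> T. (-1) ^ card T) * c (g \<circ> s))"
    by (simp add: sum_distrib_right flip: sum.inter_filter)
  also have "\<dots> = (\<Sum>s\<in>(UNIV :: ('k \<Rightarrow> 'k) set). if bij s then (-1) ^ CARD('k) * c g else 0)"
  proof (rule sum.cong)
    fix s :: "'k \<Rightarrow> 'k"
    show "(\<Sum>T | range s \<subseteq> T. (-1) ^ card T) * c (g \<circ> s) = (if bij s then (-1) ^ CARD('k) * c g else 0)"
    proof (cases "bij s")
      case True
      then have "{T. range s \<subseteq> T} = {UNIV}"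
        by (auto simp: bij_def)
      with True show ?thesis by (simp add: sym)
    next
      case False
      then have "range s \<noteq> UNIV"
        using finite_UNIV_surj_inj[of s] by (auto simp: bij_def)
      with False show ?thesis by (simp add: sum_alternating_supersets_eq_0)
    qed
  qed simp
  also have "\<dots> = of_nat (card {s :: 'k \<Rightarrow> 'k. bij s}) * ((-1) ^ CARD('k) * c g)"
    by (simp flip: sum.inter_filter)
  finally have "card {s :: 'k \<Rightarrow> 'k. bij s} = 0 \<or> c g = 0"
    by simp
  moreover have "id \<in> {s :: 'k \<Rightarrow> 'k. bij s}"
    by simp
  ultimately show ?thesis
    by (metis card_0_eq empty_iff finite)
qed

definition tensor_power :: "complex^'a::finite \<Rightarrow> complex^('k::finite \<Rightarrow> 'a)" where
  "tensor_power u = (\<chi> f. \<Prod>l\<in>UNIV. u $ f l)"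

lemma tensor_power_in_sym_space: "tensor_power u \<in> sym_space"
  by (auto simp: sym_space_def tensor_power_def intro!: prod.reindex_bij_betw)

lemma tensor_powers_in_tensor_space:
  "tensor_vec (tensor_power u) (tensor_power v) \<in> tensor_space sym_space sym_space"
  unfolding tensor_space_def by (rule vec.span_base) (auto intro: tensor_power_in_sym_space)

text \<open>Invariance under permutations is a linear condition satisfied by the generating product
  vectors, hence by their span.\<close>

lemma tensor_space_symmetric:
  fixes \<psi> :: "complex^(('k::finite \<Rightarrow> 'a::finite) \<times> ('l::finite \<Rightarrow> 'b::finite))"
  assumes "\<psi> \<in> tensor_space sym_space sym_space"
  shows "bij \<pi> \<Longrightarrow> \<psi> $ (f \<circ> \<pi>, g) = \<psi> $ (f, g)" "bij \<pi>' \<Longrightarrow> \<psi> $ (f, g \<circ> \<pi>') = \<psi> $ (f, g)"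
proof -
  have "vec.subspace {\<psi> :: complex^(('k::finite \<Rightarrow> 'a::finite) \<times> ('l::finite \<Rightarrow> 'b::finite)).
      (\<forall>f g \<pi>. bij \<pi> \<longrightarrow> \<psi> $ (f \<circ> \<pi>, g) = \<psi> $ (f, g)) \<and> (\<forall>f g \<pi>. bij \<pi> \<longrightarrow> \<psi> $ (f, g \<circ> \<pi>) = \<psi> $ (f, g))}"
    (is "vec.subspace ?T")
    by (simp add: vec.subspace_def)
  then have "tensor_space sym_space sym_space \<subseteq> ?T"
    unfolding tensor_space_def
    by (intro vec.span_minimal) (auto simp: tensor_vec_def sym_space_def)
  with assms show "bij \<pi> \<Longrightarrow> \<psi> $ (f \<circ> \<pi>, g) = \<psi> $ (f, g)" "bij \<pi>' \<Longrightarrow> \<psi> $ (f, g \<circ> \<pi>') = \<psi> $ (f, g)"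
    by blast+
qed

text \<open>The overlap with a product of tensor powers, taken without conjugation so that it is a
  polynomial in \<open>u\<close> and \<open>v\<close>. The product vector it refers to is therefore
  built from \<open>conj_vec u\<close> and \<open>conj_vec v\<close>.\<close>

definition poly_form :: "complex^(('k::finite \<Rightarrow> 'a::finite) \<times> ('l::finite \<Rightarrow> 'b::finite)) \<Rightarrow>
    complex^'a \<Rightarrow> complex^'b \<Rightarrow> complex" where
  "poly_form \<psi> u v = (\<Sum>F\<in>UNIV. \<psi> $ F * ((\<Prod>l\<in>UNIV. u $ fst F l) * (\<Prod>l\<in>UNIV. v $ snd F l)))"

lemma poly_form_eq_sum_sum:
  "poly_form \<psi> u v = (\<Sum>f\<in>UNIV. \<Sum>g\<in>UNIV. \<psi> $ (f, g) * ((\<Prod>l\<in>UNIV. u $ f l) * (\<Prod>l\<in>UNIV. v $ g l)))"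
  by (simp add: poly_form_def sum.cartesian_product case_prod_unfold)

text \<open>Polarization is applied on each side separately: in \<open>u\<close> for fixed
  \<open>v\<close>, then in \<open>v\<close> for a fixed index \<open>f\<close>.\<close>

lemma poly_form_nonzero:
  assumes \<psi>: "\<psi> \<in> tensor_space sym_space sym_space" "\<psi> \<noteq> 0"
  obtains u v where "poly_form \<psi> u v \<noteq> 0"
proof (rule ccontr)
  assume "\<not> thesis"
  with that have zero: "poly_form \<psi> u v = 0" for u v
    by blast
  have "\<psi> $ (f, g) = 0" for f g
  proof (rule symmetric_form_eq_0[where c = "\<lambda>g. \<psi> $ (f, g)"])
    fix v :: "complex^'d"
    show "(\<Sum>g\<in>UNIV. \<psi> $ (f, g) * (\<Prod>l\<in>UNIV. v $ g l)) = 0"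
    proof (rule symmetric_form_eq_0[where c = "\<lambda>f. \<Sum>g\<in>UNIV. \<psi> $ (f, g) * (\<Prod>l\<in>UNIV. v $ g l)"])
      fix u :: "complex^'b"
      show "(\<Sum>f\<in>UNIV. (\<Sum>g\<in>UNIV. \<psi> $ (f, g) * (\<Prod>l\<in>UNIV. v $ g l)) * (\<Prod>l\<in>UNIV. u $ f l)) = 0"
        using zero[of u v] by (simp add: poly_form_eq_sum_sum sum_distrib_right sum_distrib_left mult_ac)
    qed (simp add: tensor_space_symmetric[OF \<psi>(1)])
  qed (simp add: tensor_space_symmetric[OF \<psi>(1)])
  then have "\<psi> = 0"
    by (auto simp: vec_eq_iff)
  with \<psi> show False by simp
qed

definition mixed_prod :: "complex^'a::finite \<Rightarrow> complex^'a \<Rightarrow> 'k::finite set \<Rightarrow> ('k \<Rightarrow> 'a) \<Rightarrow> complex" where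
  "mixed_prod x u I f = (\<Prod>l\<in>I. x $ f l) * (\<Prod>l\<in>- I. u $ f l)"

text \<open>A coefficient in the expansion of \<open>poly_form\<close> at \<open>u + s x\<close>,
  \<open>v + t y\<close>: \<open>I\<close> and \<open>J\<close> are the sets of factors that carry
  \<open>x\<close> and \<open>y\<close>.\<close>

definition mixed_form :: "complex^(('k::finite \<Rightarrow> 'a::finite) \<times> ('l::finite \<Rightarrow> 'b::finite)) \<Rightarrow>
    complex^'a \<Rightarrow> complex^'a \<Rightarrow> 'k set \<Rightarrow> complex^'b \<Rightarrow> complex^'b \<Rightarrow> 'l set \<Rightarrow> complex" where
  "mixed_form \<psi> x u I y v J = (\<Sum>F\<in>UNIV. \<psi> $ F * (mixed_prod x u I (fst F) * mixed_prod y v J (snd F)))"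

lemma prod_eq_sum_mixed_prod:
  "(\<Prod>l\<in>UNIV. (u + s *s x) $ f l) = (\<Sum>I\<in>UNIV. s ^ card I * mixed_prod x u I f)"
proof -
  have "(\<Prod>l\<in>UNIV. (u + s *s x) $ f l) = (\<Prod>l\<in>UNIV. s * x $ f l + u $ f l)"
    by (simp add: add.commute)
  also have "\<dots> = (\<Sum>I\<in>Pow UNIV. (\<Prod>l\<in>I. s * x $ f l) * (\<Prod>l\<in>UNIV - I. u $ f l))"
    by (rule prod_add) simp
  finally show ?thesis
    by (simp add: mixed_prod_def prod.distrib mult.assoc Compl_eq_Diff_UNIV)
qed

lemma poly_form_expand:
  "poly_form \<psi> (u + s *s x) (v + t *s y) =
    (\<Sum>(I, J)\<in>UNIV. s ^ card I * t ^ card J * mixed_form \<psi> x u I y v J)"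
proof -
  have "poly_form \<psi> (u + s *s x) (v + t *s y) =
    (\<Sum>F\<in>UNIV. \<psi> $ F * (\<Sum>(I, J)\<in>UNIV \<times> UNIV.
      (s ^ card I * mixed_prod x u I (fst F)) * (t ^ card J * mixed_prod y v J (snd F))))"
    unfolding poly_form_def prod_eq_sum_mixed_prod sum_product sum.cartesian_product ..
  also have "\<dots> = (\<Sum>F\<in>UNIV. \<Sum>(I, J)\<in>UNIV.
      s ^ card I * t ^ card J * (\<psi> $ F * (mixed_prod x u I (fst F) * mixed_prod y v J (snd F))))"
    by (simp add: sum_distrib_left case_prod_unfold mult_ac)
  also have "\<dots> = (\<Sum>(I, J)\<in>UNIV. s ^ card I * t ^ card J * mixed_form \<psi> x u I y v J)"
    unfolding mixed_form_def sum_distrib_left case_prod_unfold by (rule sum.swap)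
  finally show ?thesis .
qed

lemma mixed_form_empty: "mixed_form \<psi> x u {} y v {} = poly_form \<psi> u v"
  by (simp add: mixed_form_def poly_form_def mixed_prod_def)

lemma mixed_prod_singleton_transpose:
  "mixed_prod x u {k} (f \<circ> Transposition.transpose i k) = mixed_prod x u {i} f"
proof -
  have "(\<Prod>l\<in>- {k}. u $ f (Transposition.transpose i k l)) = (\<Prod>l\<in>- {i}. u $ f l)"
    by (rule prod.reindex_bij_witness[of _ "Transposition.transpose i k" "Transposition.transpose i k"])
      (auto simp: transpose_eq_iff)
  then show ?thesis
    by (simp add: mixed_prod_def)
qed

text \<open>A transposition moves the factor carrying \<open>x\<close> or \<open>y\<close> to any
  other place. The coefficient of \<open>s t\<close> is thus \<open>n m\<close> times a single mixed
  form, which is the source of the denominator in the final bound.\<close>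

lemma mixed_form_singletons:
  fixes \<psi> :: "complex^(('k::finite \<Rightarrow> 'a::finite) \<times> ('l::finite \<Rightarrow> 'b::finite))"
  assumes \<psi>: "\<psi> \<in> tensor_space sym_space sym_space"
  shows "mixed_form \<psi> x u {k} y v J = mixed_form \<psi> x u {i} y v J"
    and "mixed_form \<psi> x u I y v {l} = mixed_form \<psi> x u I y v {j}"
proof -
  show "mixed_form \<psi> x u {k} y v J = mixed_form \<psi> x u {i} y v J"
    unfolding mixed_form_def
    by (rule sum.reindex_bij_witness[of _ "\<lambda>F. (fst F \<circ> Transposition.transpose k i, snd F)"
        "\<lambda>F. (fst F \<circ> Transposition.transpose k i, snd F)"])
      (simp_all add: tensor_space_symmetric[OF \<psi>] comp_assoc mixed_prod_singleton_transpose)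
  show "mixed_form \<psi> x u I y v {l} = mixed_form \<psi> x u I y v {j}"
    unfolding mixed_form_def
    by (rule sum.reindex_bij_witness[of _ "\<lambda>F. (fst F, snd F \<circ> Transposition.transpose l j)"
        "\<lambda>F. (fst F, snd F \<circ> Transposition.transpose l j)"])
      (simp_all add: tensor_space_symmetric[OF \<psi>] comp_assoc mixed_prod_singleton_transpose)
qed

subsection \<open>Operators acting on two tensor factors\<close>

definition slots :: "'k \<Rightarrow> 'l \<Rightarrow> ('k \<Rightarrow> 'a) \<times> ('l \<Rightarrow> 'b) \<Rightarrow> 'a \<times> 'b" where
  "slots i j F = (fst F i, snd F j)"

definition set_slots :: "'k \<Rightarrow> 'l \<Rightarrow> 'a \<times> 'b \<Rightarrow> ('k \<Rightarrow> 'a) \<times> ('l \<Rightarrow> 'b) \<Rightarrow> ('k \<Rightarrow> 'a) \<times> ('l \<Rightarrow> 'b)" where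
  "set_slots i j q F = ((fst F)(i := fst q), (snd F)(j := snd q))"

text \<open>\<open>Y\<close> on the factors \<open>i\<close> and \<open>j\<close>, tensored with the
  identity: the condition says that \<open>F\<close> and \<open>G\<close> agree on all other
  factors.\<close>

definition local_op :: "'k \<Rightarrow> 'l \<Rightarrow> ('a::finite \<times> 'b::finite) operator \<Rightarrow>
    (('k::finite \<Rightarrow> 'a) \<times> ('l::finite \<Rightarrow> 'b)) operator" where
  "local_op i j Y = (\<chi> F G. if G = set_slots i j (slots i j G) F then Y $ slots i j F $ slots i j G else 0)"

lemma slots_set_slots [simp]: "slots i j (set_slots i j q F) = q"
  by (simp add: slots_def set_slots_def)

lemma set_slots_commute: "G = set_slots i j (slots i j G) F \<longleftrightarrow> F = set_slots i j (slots i j F) G"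
  by (auto simp: slots_def set_slots_def prod_eq_iff fun_eq_iff)

lemma adj_local_op: "adj (local_op i j Y) = local_op i j (adj Y)"
  by (simp add: vec_eq_iff adj_def local_op_def set_slots_commute[symmetric])

lemma sum_set_slots:
  fixes h :: "('k::finite \<Rightarrow> 'a::finite) \<times> ('l::finite \<Rightarrow> 'b::finite) \<Rightarrow> 'c::comm_monoid_add"
  shows "(\<Sum>G\<in>UNIV. if G = set_slots i j (slots i j G) F then h G else 0) =
    (\<Sum>q\<in>UNIV. h (set_slots i j q F))"
proof -
  have "(\<Sum>G\<in>UNIV. if G = set_slots i j (slots i j G) F then h G else 0) =
      (\<Sum>G | G = set_slots i j (slots i j G) F. h G)"
    by (simp flip: sum.inter_filter)
  also have "\<dots> = (\<Sum>q\<in>UNIV. h (set_slots i j q F))"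
    by (rule sum.reindex_bij_witness[of _ "\<lambda>q. set_slots i j q F" "slots i j"]) auto
  finally show ?thesis .
qed

lemma sum_slots:
  fixes h :: "('k::finite \<Rightarrow> 'a::finite) \<times> ('l::finite \<Rightarrow> 'b::finite) \<Rightarrow> 'c::comm_monoid_add"
  shows "(\<Sum>F\<in>UNIV. h F) = (\<Sum>p\<in>UNIV. \<Sum>F | slots i j F = p. h F)"
  using sum.group[of "UNIV :: (('k \<Rightarrow> 'a) \<times> ('l \<Rightarrow> 'b)) set" UNIV "slots i j" h] by simp

lemma marginal_component:
  "marginal i j \<rho> $ p $ q = (\<Sum>F | slots i j F = p. \<rho> $ F $ set_slots i j q F)"
proof -
  have "{F. slots i j F = p} = {f. f i = fst p} \<times> {g. g j = snd p}"
    by (auto simp: slots_def prod_eq_iff)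
  then show ?thesis
    by (simp add: marginal_def sum.cartesian_product set_slots_def case_prod_unfold)
qed

lemma adj_marginal:
  assumes "adj \<rho> = \<rho>"
  shows "adj (marginal i j \<rho>) = marginal i j \<rho>"
proof -
  have herm: "cnj (\<rho> $ F $ G) = \<rho> $ G $ F" for F G
    using arg_cong[OF assms, of "\<lambda>A. A $ G $ F"] by (simp add: adj_def)
  have "cnj (marginal i j \<rho> $ q $ p) = marginal i j \<rho> $ p $ q" for p q
    unfolding marginal_component cnj_sum herm
    by (rule sum.reindex_bij_witness[of _ "set_slots i j q" "set_slots i j p"])
      (auto simp: slots_def set_slots_def)
  then show ?thesis
    by (simp add: vec_eq_iff adj_def)
qed

text \<open>The partial trace is adjoint to tensoring with the identity, which moves observables
  from the marginal to the extension.\<close>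

lemma inner_marginal: "Y \<bullet> marginal i j \<rho> = local_op i j Y \<bullet> \<rho>"
proof -
  have "local_op i j Y \<bullet> \<rho> = (\<Sum>F\<in>UNIV. \<Sum>G\<in>UNIV.
      if G = set_slots i j (slots i j G) F then Y $ slots i j F $ slots i j G \<bullet> \<rho> $ F $ G else 0)"
    unfolding inner_vec_def local_op_def by (simp add: if_distrib[of "\<lambda>a. a \<bullet> _"] cong: if_cong)
  also have "\<dots> = (\<Sum>p\<in>UNIV. \<Sum>F | slots i j F = p. \<Sum>q\<in>UNIV. Y $ p $ q \<bullet> \<rho> $ F $ set_slots i j q F)"
    unfolding sum_set_slots by (subst sum_slots[of _ i j]) (auto intro!: sum.cong)
  also have "\<dots> = Y \<bullet> marginal i j \<rho>"
    unfolding inner_vec_def marginal_component inner_sum_right by (intro sum.cong sum.swap refl)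
  finally show ?thesis by simp
qed

text \<open>The partial overlap of \<open>\<psi>\<close> with \<open>u\<close> and \<open>v\<close>
  on all factors except \<open>i\<close> and \<open>j\<close>, unconjugated like
  \<open>poly_form\<close>.\<close>

definition contract :: "'k \<Rightarrow> 'l \<Rightarrow> complex^(('k::finite \<Rightarrow> 'a::finite) \<times> ('l::finite \<Rightarrow> 'b::finite)) \<Rightarrow>
    complex^'a \<Rightarrow> complex^'b \<Rightarrow> complex^('a \<times> 'b)" where
  "contract i j \<psi> u v = (\<chi> q. \<Sum>F | slots i j F = q.
    \<psi> $ F * ((\<Prod>l\<in>- {i}. u $ fst F l) * (\<Prod>l\<in>- {j}. v $ snd F l)))"

lemma sum_mult_contract:
  "(\<Sum>q\<in>UNIV. a q * contract i j \<psi> u v $ q) =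
    (\<Sum>F\<in>UNIV. \<psi> $ F * (a (slots i j F) * ((\<Prod>l\<in>- {i}. u $ fst F l) * (\<Prod>l\<in>- {j}. v $ snd F l))))"
  unfolding sum_slots[of _ i j] by (auto simp: contract_def sum_distrib_left mult_ac intro!: sum.cong)

lemma contract_mixed_form:
  "(\<Sum>q\<in>UNIV. x $ fst q * y $ snd q * contract i j \<psi> u v $ q) = mixed_form \<psi> x u {i} y v {j}"
  unfolding sum_mult_contract by (simp add: mixed_form_def mixed_prod_def slots_def mult_ac)

definition conj_vec :: "complex^'i \<Rightarrow> complex^'i" where
  "conj_vec u = (\<chi> i. cnj (u $ i))"

lemma mixed_prod_same: "mixed_prod u u I f = (\<Prod>l\<in>UNIV. u $ f l)"
  unfolding mixed_prod_def using prod.union_disjoint[of I "- I" "\<lambda>l. u $ f l"] by simp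

lemma cinner_tensor_power:
  "cinner (tensor_vec (tensor_power (conj_vec u)) (tensor_power (conj_vec v))) \<psi> = poly_form \<psi> u v"
  by (simp add: cinner_def tensor_vec_def tensor_power_def conj_vec_def poly_form_def mult_ac)

text \<open>The Hermitian \<open>Y\<close> is moved to the left, where it changes one pair of
  factors of a product vector; the other factors contract \<open>\<psi>\<close>.\<close>

lemma cinner_tensor_power_local_op:
  assumes Y: "adj Y = Y"
  shows "cinner (tensor_vec (tensor_power (conj_vec u)) (tensor_power (conj_vec v))) (local_op i j Y *v \<psi>) =
    cinner (Y *v tensor_vec (conj_vec u) (conj_vec v)) (contract i j \<psi> u v)"
proof -
  let ?x = "tensor_vec (tensor_power (conj_vec u)) (tensor_power (conj_vec v))"
  let ?w = "tensor_vec (conj_vec u) (conj_vec v)"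
  let ?r = "\<lambda>F. (\<Prod>l\<in>- {i}. u $ fst F l) * (\<Prod>l\<in>- {j}. v $ snd F l)"
  have x: "?x $ set_slots i j q F = ?w $ q * cnj (?r F)" for q F
  proof -
    have "(\<Prod>l\<in>UNIV. u $ ((fst F)(i := fst q)) l) = u $ fst q * (\<Prod>l\<in>- {i}. u $ fst F l)" for u :: "complex^'a"
      unfolding mixed_prod_same[of u "{i}", symmetric] mixed_prod_def
      by (simp cong: prod.cong_simp)
    moreover have "(\<Prod>l\<in>UNIV. v $ ((snd F)(j := snd q)) l) = v $ snd q * (\<Prod>l\<in>- {j}. v $ snd F l)" for v :: "complex^'b"
      unfolding mixed_prod_same[of v "{j}", symmetric] mixed_prod_def
      by (simp cong: prod.cong_simp)
    ultimately show ?thesis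
      by (simp add: tensor_vec_def tensor_power_def set_slots_def) (simp add: conj_vec_def mult_ac)
  qed
  have "(local_op i j Y *v ?x) $ F = (Y *v ?w) $ slots i j F * cnj (?r F)" for F
  proof -
    have "(local_op i j Y *v ?x) $ F = (\<Sum>G\<in>UNIV.
      if G = set_slots i j (slots i j G) F then Y $ slots i j F $ slots i j G * ?x $ G else 0)"
      unfolding matrix_vector_mult_def local_op_def
      by (simp add: if_distrib[of "\<lambda>a. a * _"] cong: if_cong)
    also have "\<dots> = (\<Sum>q\<in>UNIV. Y $ slots i j F $ q * (?w $ q * cnj (?r F)))"
      unfolding sum_set_slots slots_set_slots x ..
    finally show ?thesis
      by (simp add: matrix_vector_mult_def sum_distrib_left mult_ac)
  qed
  then have "cinner ?x (local_op i j Y *v \<psi>) =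
      (\<Sum>F\<in>UNIV. \<psi> $ F * (cnj ((Y *v ?w) $ slots i j F) * ?r F))"
    unfolding cinner_adj adj_local_op Y by (simp add: cinner_def mult_ac)
  also have "\<dots> = cinner (Y *v ?w) (contract i j \<psi> u v)"
    unfolding cinner_def sum_mult_contract ..
  finally show ?thesis .
qed

subsection \<open>Growth bounds and low-order coefficients\<close>

lemma Re_mult_of_real: "Re (z * of_real r) = Re z * r"
  by simp

lemma cnj_sgn_mult: "cnj (sgn z) * z = of_real (cmod z)"
proof (cases "z = 0")
  case False
  have "cnj (sgn z) * z = z * cnj z / of_real (cmod z)"
    by (simp add: sgn_eq)
  also have "\<dots> = of_real (cmod z)"
    unfolding complex_norm_square[symmetric] using False by (simp add: power2_eq_square)
  finally show ?thesis .
qed simp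

text \<open>A polynomial that lies below \<open>g\<close> to the right of \<open>0\<close> and meets
  it at \<open>0\<close> cannot have the larger slope there. Exponents may repeat, hence the sums
  over all terms of one exponent.\<close>

lemma derivative_at_0_le:
  fixes e :: "'k \<Rightarrow> real"
  assumes K: "finite K" and le: "\<And>\<tau>. \<tau> \<ge> 0 \<Longrightarrow> (\<Sum>k\<in>K. e k * \<tau> ^ a k) \<le> g \<tau>"
    and eq: "(\<Sum>k | k \<in> K \<and> a k = 0. e k) = g 0" and g: "(g has_real_derivative g') (at 0)"
  shows "(\<Sum>k | k \<in> K \<and> a k = 1. e k) \<le> g'"
proof (rule ccontr)
  let ?h = "\<lambda>\<tau>. g \<tau> - (\<Sum>k\<in>K. e k * \<tau> ^ a k)"
  assume "\<not> ?thesis"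
  moreover have "(?h has_real_derivative g' - (\<Sum>k\<in>K. e k * (real (a k) * 0 ^ (a k - 1)))) (at 0)"
    using DERIV_pow[of _ 0] by (intro DERIV_diff g DERIV_sum DERIV_cmult) (metis One_nat_def)
  moreover have "(\<Sum>k\<in>K. e k * (real (a k) * 0 ^ (a k - 1))) = (\<Sum>k | k \<in> K \<and> a k = 1. e k)"
    unfolding sum.inter_filter[OF K] by (intro sum.cong) (auto simp: power_0_left)
  ultimately obtain d where d: "d > 0" "\<And>x. 0 < x \<Longrightarrow> x < d \<Longrightarrow> ?h (0 + x) < ?h 0"
    using DERIV_neg_dec_right[of ?h "g' - (\<Sum>k | k \<in> K \<and> a k = 1. e k)" 0] by auto
  have "?h 0 = 0"
    unfolding eq[symmetric] sum.inter_filter[OF K] by (simp flip: sum_subtractf) (intro sum.neutral, auto)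
  with d(2)[of "d / 2"] d(1) le[of "d / 2"] show False
    by simp
qed

text \<open>A geometric sum; the bounds on \<open>a\<close> and \<open>b\<close> turn congruence
  modulo \<open>N\<close> into equality.\<close>

lemma sum_roots_of_unity_powers:
  assumes "a < N" "b < N"
  shows "(\<Sum>j<N. (cis (2 * pi / N) ^ j) ^ a * cnj (cis (2 * pi / N) ^ j) ^ b) = (if a = b then of_nat N else 0)"
proof (cases "a = b")
  case True
  have "(cis (2 * pi / N) ^ j) ^ a * cnj (cis (2 * pi / N) ^ j) ^ a = 1" for j
    unfolding power_mult_distrib[symmetric] complex_norm_square[symmetric] by (simp add: norm_power)
  with True show ?thesis by simp
next
  case False
  define w where "w = cis (2 * pi / N)"
  define r where "r = w ^ a * cnj w ^ b"
  have N: "N > 0" using assms by simp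
  have wN: "w ^ N = 1"
    using N by (simp add: w_def Complex.DeMoivre)
  have ww: "cnj w ^ b * w ^ b = 1"
    unfolding power_mult_distrib[symmetric] mult.commute[of "cnj w"] complex_norm_square[symmetric]
    by (simp add: w_def)
  have "r \<noteq> 1"
  proof
    assume "r = 1"
    have "w ^ a = r * w ^ b"
      unfolding r_def mult.assoc ww by simp
    with \<open>r = 1\<close> have "cis (2 * pi * a / N) = cis (2 * pi * b / N)"
      by (simp add: w_def Complex.DeMoivre mult_ac)
    moreover have "inj_on (\<lambda>k. cis (2 * pi * real k / real N)) {..<N}"
      using Complex.bij_betw_roots_unity[OF N] by (rule bij_betw_imp_inj_on)
    ultimately show False
      using assms False by (auto dest: inj_onD)
  qed
  moreover have "r ^ N = 1"
  proof -
    have "r ^ N = (w ^ N) ^ a * cnj (w ^ N) ^ b"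
      by (simp add: r_def power_mult_distrib flip: power_mult) (simp add: mult.commute)
    then show ?thesis by (simp add: wN)
  qed
  ultimately have "(\<Sum>j<N. r ^ j) = 0"
    using geometric_sum[of r N] by simp
  moreover have "(w ^ j) ^ a * cnj (w ^ j) ^ b = r ^ j" for j
    by (simp add: r_def power_mult_distrib flip: power_mult) (simp add: mult.commute)
  ultimately show ?thesis
    using False by (simp add: w_def[symmetric])
qed

text \<open>Both parts compare the derivatives at \<open>0\<close> of the two sides of the growth bound. In the second
  part the substitution \<open>s \<mapsto> z s\<close>, \<open>t \<mapsto> cnj z t\<close> is averaged over the roots of unity \<open>z\<close>,
  which leaves only the terms with \<open>\<alpha> k = \<beta> k\<close>.\<close>

context
  fixes K :: "'k set" and C :: "'k \<Rightarrow> complex" and \<alpha> \<beta> :: "'k \<Rightarrow> nat" and c0 :: complex and a b :: real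
  assumes K: "finite K" and c0: "(\<Sum>k | k \<in> K \<and> \<alpha> k = 0 \<and> \<beta> k = 0. C k) = c0" "c0 \<noteq> 0"
    and growth: "\<And>s t. cmod (\<Sum>k\<in>K. s ^ \<alpha> k * t ^ \<beta> k * C k) \<le> cmod c0 * exp (a * (cmod s)\<^sup>2 + b * (cmod t)\<^sup>2)"
begin

lemma Re_growth:
  "Re (cnj c0 * (\<Sum>k\<in>K. s ^ \<alpha> k * t ^ \<beta> k * C k)) \<le> (cmod c0)\<^sup>2 * exp (a * (cmod s)\<^sup>2 + b * (cmod t)\<^sup>2)"
proof -
  have "Re (cnj c0 * (\<Sum>k\<in>K. s ^ \<alpha> k * t ^ \<beta> k * C k)) \<le> cmod c0 * cmod (\<Sum>k\<in>K. s ^ \<alpha> k * t ^ \<beta> k * C k)"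
    by (metis complex_Re_le_cmod complex_mod_cnj norm_mult)
  also have "\<dots> \<le> cmod c0 * (cmod c0 * exp (a * (cmod s)\<^sup>2 + b * (cmod t)\<^sup>2))"
    by (intro mult_left_mono growth) simp
  finally show ?thesis by (simp add: power2_eq_square)
qed

lemma first_order_coeff_eq_0: "(\<Sum>k | k \<in> K \<and> \<alpha> k = 1 \<and> \<beta> k = 0. C k) = 0" (is "?D = 0")
proof -
  \<comment> \<open>Along \<open>s = \<omega> \<tau>\<close>, \<open>t = 0\<close> the linear term
    is the squared modulus of \<open>cnj c0 * ?D\<close>, while the growth bound has derivative
    \<open>0\<close>.\<close>
  define \<omega> where "\<omega> = cnj (cnj c0 * ?D)"
  let ?K = "{k \<in> K. \<beta> k = 0}"
  have "(\<Sum>k | k \<in> ?K \<and> \<alpha> k = 1. Re (cnj c0 * (\<omega> ^ \<alpha> k * C k))) \<le> 0"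
  proof (rule derivative_at_0_le[where g = "\<lambda>\<tau>. (cmod c0)\<^sup>2 * exp (a * (cmod \<omega> * \<tau>)\<^sup>2)"])
    show "finite ?K" using K by simp
    show "(\<Sum>k\<in>?K. Re (cnj c0 * (\<omega> ^ \<alpha> k * C k)) * \<tau> ^ \<alpha> k) \<le> (cmod c0)\<^sup>2 * exp (a * (cmod \<omega> * \<tau>)\<^sup>2)"
      if "\<tau> \<ge> 0" for \<tau>
    proof -
      have "(\<Sum>k\<in>K. (\<omega> * of_real \<tau>) ^ \<alpha> k * 0 ^ \<beta> k * C k) = (\<Sum>k\<in>?K. \<omega> ^ \<alpha> k * of_real (\<tau> ^ \<alpha> k) * C k)"
        unfolding sum.inter_filter[OF K] by (intro sum.cong) (auto simp: power_0_left power_mult_distrib)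
      then have "Re (cnj c0 * (\<Sum>k\<in>K. (\<omega> * of_real \<tau>) ^ \<alpha> k * 0 ^ \<beta> k * C k)) =
          (\<Sum>k\<in>?K. Re (cnj c0 * (\<omega> ^ \<alpha> k * C k) * of_real (\<tau> ^ \<alpha> k)))"
        by (simp only: sum_distrib_left Re_sum) (simp only: mult_ac)
      with Re_growth[of "\<omega> * of_real \<tau>" 0] that show ?thesis
        unfolding Re_mult_of_real by (simp add: norm_mult)
    qed
    show "(\<Sum>k | k \<in> ?K \<and> \<alpha> k = 0. Re (cnj c0 * (\<omega> ^ \<alpha> k * C k))) = (cmod c0)\<^sup>2 * exp (a * (cmod \<omega> * 0)\<^sup>2)"
    proof -
      have "(\<Sum>k | k \<in> ?K \<and> \<alpha> k = 0. Re (cnj c0 * (\<omega> ^ \<alpha> k * C k))) = Re (cnj c0 * (\<Sum>k | k \<in> K \<and> \<alpha> k = 0 \<and> \<beta> k = 0. C k))"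
        unfolding sum_distrib_left Re_sum by (intro sum.cong) auto
      then show ?thesis
        unfolding c0 mult.commute[of "cnj c0" c0] complex_norm_square[symmetric] by simp
    qed
    show "((\<lambda>\<tau>. (cmod c0)\<^sup>2 * exp (a * (cmod \<omega> * \<tau>)\<^sup>2)) has_real_derivative 0) (at 0)"
      by (auto intro!: derivative_eq_intros)
  qed
  also have "(\<Sum>k | k \<in> ?K \<and> \<alpha> k = 1. Re (cnj c0 * (\<omega> ^ \<alpha> k * C k))) = Re (\<omega> * (cnj c0 * ?D))"
    unfolding sum_distrib_left Re_sum by (intro sum.cong) (auto simp: mult_ac)
  also have "\<dots> = (cmod (cnj c0 * ?D))\<^sup>2"
    unfolding \<omega>_def mult.commute[of "cnj _"] complex_norm_square[symmetric] by simp
  finally show ?thesis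
    using c0(2) by simp
qed

lemma mixed_second_order_coeff_bound:
  fixes p q :: real
  assumes pq: "p \<ge> 0" "q \<ge> 0"
  shows "p * q * cmod (\<Sum>k | k \<in> K \<and> \<alpha> k = 1 \<and> \<beta> k = 1. C k) \<le> cmod c0 * (a * p\<^sup>2 + b * q\<^sup>2)" (is "_ * cmod ?D \<le> _")
proof -
  \<comment> \<open>The phase that makes \<open>cnj c0 * ?D\<close> real and nonnegative; the
    default \<open>1\<close> keeps \<open>\<omega>\<close> of modulus one when
    \<open>?D = 0\<close>.\<close>
  define \<omega> where "\<omega> = (if ?D = 0 then 1 else cnj (sgn (cnj c0 * ?D)))"
  have \<omega>1: "cmod \<omega> = 1"
    using c0(2) by (simp add: \<omega>_def norm_sgn)
  \<comment> \<open>Larger than every exponent, so that the roots of unity tell all exponents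
    apart.\<close>
  define N where "N = Suc (Max (insert 0 (\<alpha> ` K \<union> \<beta> ` K)))"
  have N: "\<alpha> k < N" "\<beta> k < N" if "k \<in> K" for k
    using K that unfolding N_def less_Suc_eq_le by (auto intro!: Max_ge)
  have "N > 0" by (simp add: N_def)
  define w where "w j = cis (2 * pi / N) ^ j" for j
  have w1: "cmod (w j) = 1" for j
    by (simp add: w_def norm_power)
  let ?K = "{k \<in> K. \<alpha> k = \<beta> k}"
  let ?e = "\<lambda>k. Re (cnj c0 * ((\<omega> * of_real (p * q)) ^ \<alpha> k * C k))"
  have "(\<Sum>k | k \<in> ?K \<and> \<alpha> k = 1. ?e k) \<le> (cmod c0)\<^sup>2 * (a * p\<^sup>2 + b * q\<^sup>2)"
  proof (rule derivative_at_0_le[where g = "\<lambda>\<tau>. (cmod c0)\<^sup>2 * exp ((a * p\<^sup>2 + b * q\<^sup>2) * \<tau>)"])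
    show "finite ?K" using K by simp
    show "(\<Sum>k\<in>?K. ?e k * \<tau> ^ \<alpha> k) \<le> (cmod c0)\<^sup>2 * exp ((a * p\<^sup>2 + b * q\<^sup>2) * \<tau>)"
      if \<tau>: "\<tau> \<ge> 0" for \<tau>
    proof -
      \<comment> \<open>The square roots make \<open>s * t\<close> and the exponent of the growth
        bound linear in \<open>\<tau>\<close>, so the mixed second-order term becomes a first
        derivative.\<close>
      define s where "s = \<omega> * of_real (p * sqrt \<tau>)"
      define t where "t = complex_of_real (q * sqrt \<tau>)"
      have st: "s * t = \<omega> * of_real (p * q) * of_real \<tau>"
        using \<tau> by (simp add: s_def t_def flip: of_real_mult)
      have nst: "(cmod s)\<^sup>2 = p\<^sup>2 * \<tau>" "(cmod t)\<^sup>2 = q\<^sup>2 * \<tau>"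
        using \<tau> by (simp_all add: s_def t_def norm_mult \<omega>1 power_mult_distrib)
      have "(\<Sum>j<N. \<Sum>k\<in>K. (s * w j) ^ \<alpha> k * (t * cnj (w j)) ^ \<beta> k * C k) =
          (\<Sum>k\<in>K. s ^ \<alpha> k * t ^ \<beta> k * C k * (\<Sum>j<N. w j ^ \<alpha> k * cnj (w j) ^ \<beta> k))"
        by (subst sum.swap) (simp add: sum_distrib_left power_mult_distrib mult_ac)
      also have "\<dots> = (\<Sum>k\<in>?K. of_nat N * ((s * t) ^ \<alpha> k * C k))"
        unfolding sum.inter_filter[OF K]
      proof (rule sum.cong)
        fix k assume "k \<in> K"
        then have "(\<Sum>j<N. w j ^ \<alpha> k * cnj (w j) ^ \<beta> k) = (if \<alpha> k = \<beta> k then of_nat N else 0)"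
          unfolding w_def by (intro sum_roots_of_unity_powers N)
        then show "s ^ \<alpha> k * t ^ \<beta> k * C k * (\<Sum>j<N. w j ^ \<alpha> k * cnj (w j) ^ \<beta> k) =
            (if \<alpha> k = \<beta> k then of_nat N * ((s * t) ^ \<alpha> k * C k) else 0)"
          by (simp add: power_mult_distrib)
      qed simp
      also have "\<dots> = of_nat N * (\<Sum>k\<in>?K. (s * t) ^ \<alpha> k * C k)"
        by (simp add: sum_distrib_left)
      finally have avg: "of_nat N * (\<Sum>k\<in>?K. (s * t) ^ \<alpha> k * C k) =
        (\<Sum>j<N. \<Sum>k\<in>K. (s * w j) ^ \<alpha> k * (t * cnj (w j)) ^ \<beta> k * C k)" ..
      have "real N * Re (cnj c0 * (\<Sum>k\<in>?K. (s * t) ^ \<alpha> k * C k)) =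
          Re (cnj c0 * (of_nat N * (\<Sum>k\<in>?K. (s * t) ^ \<alpha> k * C k)))"
        by (simp add: algebra_simps)
      also have "\<dots> = (\<Sum>j<N. Re (cnj c0 * (\<Sum>k\<in>K. (s * w j) ^ \<alpha> k * (t * cnj (w j)) ^ \<beta> k * C k)))"
        unfolding avg by (simp only: sum_distrib_left Re_sum)
      also have "\<dots> \<le> (\<Sum>j<N. (cmod c0)\<^sup>2 * exp (a * (cmod (s * w j))\<^sup>2 + b * (cmod (t * cnj (w j)))\<^sup>2))"
        by (intro sum_mono Re_growth)
      also have "\<dots> = real N * ((cmod c0)\<^sup>2 * exp ((a * p\<^sup>2 + b * q\<^sup>2) * \<tau>))"
        by (simp add: norm_mult w1 nst algebra_simps)
      finally have "Re (cnj c0 * (\<Sum>k\<in>?K. (s * t) ^ \<alpha> k * C k)) \<le> (cmod c0)\<^sup>2 * exp ((a * p\<^sup>2 + b * q\<^sup>2) * \<tau>)"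
        using \<open>N > 0\<close> by simp
      also have "Re (cnj c0 * (\<Sum>k\<in>?K. (s * t) ^ \<alpha> k * C k)) =
          (\<Sum>k\<in>?K. Re (cnj c0 * ((\<omega> * of_real (p * q)) ^ \<alpha> k * C k) * of_real (\<tau> ^ \<alpha> k)))"
        unfolding st by (simp only: sum_distrib_left Re_sum power_mult_distrib[of _ "of_real \<tau>"] of_real_power)
          (simp only: mult_ac)
      finally show ?thesis
        unfolding Re_mult_of_real .
    qed
    show "(\<Sum>k | k \<in> ?K \<and> \<alpha> k = 0. ?e k) = (cmod c0)\<^sup>2 * exp ((a * p\<^sup>2 + b * q\<^sup>2) * 0)"
    proof -
      have "(\<Sum>k | k \<in> ?K \<and> \<alpha> k = 0. ?e k) = Re (cnj c0 * (\<Sum>k | k \<in> K \<and> \<alpha> k = 0 \<and> \<beta> k = 0. C k))"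
        unfolding sum_distrib_left Re_sum by (intro sum.cong) auto
      then show ?thesis
        unfolding c0 mult.commute[of "cnj c0" c0] complex_norm_square[symmetric] by simp
    qed
    show "((\<lambda>\<tau>. (cmod c0)\<^sup>2 * exp ((a * p\<^sup>2 + b * q\<^sup>2) * \<tau>)) has_real_derivative
        (cmod c0)\<^sup>2 * (a * p\<^sup>2 + b * q\<^sup>2)) (at 0)"
      by (auto intro!: derivative_eq_intros)
  qed
  also have "(\<Sum>k | k \<in> ?K \<and> \<alpha> k = 1. ?e k) = Re (\<omega> * (cnj c0 * ?D)) * (p * q)"
    unfolding Re_mult_of_real[symmetric] sum_distrib_left sum_distrib_right Re_sum
    by (intro sum.cong) (auto simp: mult_ac)
  also have "Re (\<omega> * (cnj c0 * ?D)) = cmod c0 * cmod ?D"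
  proof (cases "?D = 0")
    case False
    then have "\<omega> * (cnj c0 * ?D) = of_real (cmod (cnj c0 * ?D))"
      unfolding \<omega>_def by (simp only: if_False cnj_sgn_mult)
    then show ?thesis
      by (simp only: Re_complex_of_real norm_mult complex_mod_cnj)
  qed simp
  finally have "cmod c0 * (p * q * cmod ?D) \<le> cmod c0 * (cmod c0 * (a * p\<^sup>2 + b * q\<^sup>2))"
    by (simp add: power2_eq_square mult_ac)
  then show ?thesis
    using c0(2) by simp
qed

end

subsection \<open>Product vectors of maximal overlap\<close>

lemma poly_form_scale:
  fixes \<psi> :: "complex^(('k::finite \<Rightarrow> 'a::finite) \<times> ('l::finite \<Rightarrow> 'b::finite))"
  shows "poly_form \<psi> (a *s u) (b *s v) = a ^ CARD('k) * b ^ CARD('l) * poly_form \<psi> u v"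
  by (simp add: poly_form_def prod.distrib sum_distrib_left mult_ac)

lemma unit_vector_decomposition:
  fixes u :: "complex^'i::finite"
  obtains a where "norm a = 1" "u = of_real (norm u) *s a"
proof (cases "u = 0")
  case True
  obtain a :: "complex^'i" where "norm a = 1"
    using vector_choose_size[of 1] by auto
  with True that[of a] show thesis
    by simp
next
  case False
  then show thesis
    by (intro that[of "(1 / norm u) *\<^sub>R u"]) (simp_all flip: scaleR_eq_of_real_smult)
qed

text \<open>Compactness gives a maximum over unit vectors, homogeneity extends it to all vectors,
  and polarization makes it nonzero.\<close>

lemma poly_form_maximizer:
  fixes \<psi> :: "complex^(('k::finite \<Rightarrow> 'a::finite) \<times> ('l::finite \<Rightarrow> 'b::finite))"
  assumes \<psi>: "\<psi> \<in> tensor_space sym_space sym_space" "\<psi> \<noteq> 0"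
  obtains u v where "norm u = 1" "norm v = 1" "poly_form \<psi> u v \<noteq> 0"
    "\<And>u' v'. cmod (poly_form \<psi> u' v') \<le> cmod (poly_form \<psi> u v) * (norm u' ^ CARD('k) * norm v' ^ CARD('l))"
proof -
  let ?g = "\<lambda>w. cmod (poly_form \<psi> (fst w) (snd w))"
  let ?S = "sphere (0 :: complex^'a) 1 \<times> sphere (0 :: complex^'b) 1"
  have "?S \<noteq> {}"
    using vector_choose_size[of 1] by force
  moreover have "compact ?S"
    by (intro compact_Times compact_sphere)
  moreover have "continuous_on ?S ?g"
    unfolding poly_form_def by (intro continuous_intros)
  ultimately obtain w where w: "w \<in> ?S" and max: "\<And>w'. w' \<in> ?S \<Longrightarrow> ?g w' \<le> ?g w"
    using continuous_attains_sup[of ?S ?g] by blast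
  have le: "cmod (poly_form \<psi> u' v') \<le> ?g w * (norm u' ^ CARD('k) * norm v' ^ CARD('l))" for u' v'
  proof -
    obtain a where a: "norm a = 1" "u' = of_real (norm u') *s a"
      by (rule unit_vector_decomposition)
    obtain b where b: "norm b = 1" "v' = of_real (norm v') *s b"
      by (rule unit_vector_decomposition)
    have "cmod (poly_form \<psi> u' v') = norm u' ^ CARD('k) * norm v' ^ CARD('l) * ?g (a, b)"
      by (subst a(2), subst b(2)) (simp add: poly_form_scale norm_mult norm_power)
    also have "\<dots> \<le> norm u' ^ CARD('k) * norm v' ^ CARD('l) * ?g w"
      using a b by (intro mult_left_mono max) auto
    finally show ?thesis by (simp add: mult_ac)
  qed
  have "?g w \<noteq> 0"
  proof
    assume "?g w = 0"
    with le have "poly_form \<psi> u' v' = 0" for u' v'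
      by (metis mult_zero_left norm_le_zero_iff)
    with poly_form_nonzero[OF \<psi>] show False by blast
  qed
  with w le that[of "fst w" "snd w"] show thesis
    by (auto simp: mem_Times_iff)
qed

lemma cinner_zero_left [simp]: "cinner 0 x = 0" and cinner_zero_right [simp]: "cinner x 0 = 0"
  by (simp_all add: cinner_def)

lemma cinner_diff_left: "cinner (x - y) z = cinner x z - cinner y z"
  by (simp add: cinner_def algebra_simps sum_subtractf)

lemma norm_sq_orthogonal:
  assumes "cinner u x = 0"
  shows "(norm (u + s *s x))\<^sup>2 = (norm u)\<^sup>2 + (cmod s)\<^sup>2 * (norm x)\<^sup>2"
proof -
  have "u \<bullet> (s *s x) = 0"
    using assms by (simp add: inner_eq_Re_cinner cinner_scale_right)
  then show ?thesis
    by (simp add: norm_add_Pythagorean orthogonal_def norm_smult_complex power_mult_distrib)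
qed

text \<open>An orthogonal perturbation changes the squared norm only at second order, and
  \<open>1 + z \<le> exp z\<close> gives the form required by the growth bound.\<close>

lemma norm_power_orthogonal_le:
  assumes "cinner u x = 0" "norm u = 1"
  shows "norm (u + s *s x) ^ n \<le> exp (real n * (norm x)\<^sup>2 / 2 * (cmod s)\<^sup>2)"
proof -
  let ?e = "(norm x)\<^sup>2 / 2 * (cmod s)\<^sup>2"
  have "(norm (u + s *s x))\<^sup>2 \<le> exp ((cmod s)\<^sup>2 * (norm x)\<^sup>2)"
    using exp_ge_add_one_self[of "(cmod s)\<^sup>2 * (norm x)\<^sup>2"] assms by (simp add: norm_sq_orthogonal)
  also have "\<dots> = (exp ?e)\<^sup>2"
    by (simp flip: exp_double)
  finally have "norm (u + s *s x) \<le> exp ?e"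
    by (rule power2_le_imp_le) simp
  then have "norm (u + s *s x) ^ n \<le> exp ?e ^ n"
    by (intro power_mono) auto
  then show ?thesis
    by (simp add: mult.assoc flip: exp_of_nat_mult)
qed

text \<open>Exponents in the expansion are cardinalities, so low-order coefficients run over empty
  and singleton sets. The third equation lists its conditions in the order needed when
  \<open>s\<close> and \<open>t\<close> trade roles.\<close>

lemma sum_card_1:
  fixes h :: "'k::finite set \<times> 'l::finite set \<Rightarrow> complex"
  shows "(\<Sum>k | k \<in> UNIV \<and> card (fst k) = 0 \<and> card (snd k) = 0. h k) = h ({}, {})"
    and "(\<Sum>k | k \<in> UNIV \<and> card (fst k) = 1 \<and> card (snd k) = 0. h k) = (\<Sum>i\<in>UNIV. h ({i}, {}))"
    and "(\<Sum>k | k \<in> UNIV \<and> card (snd k) = 1 \<and> card (fst k) = 0. h k) = (\<Sum>j\<in>UNIV. h ({}, {j}))"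
    and "(\<Sum>k | k \<in> UNIV \<and> card (fst k) = 1 \<and> card (snd k) = 1. h k) = (\<Sum>(i, j)\<in>UNIV. h ({i}, {j}))"
proof -
  have "{k :: 'k set \<times> 'l set. k \<in> UNIV \<and> card (fst k) = 0 \<and> card (snd k) = 0} = {({}, {})}"
    by auto
  then show "(\<Sum>k | k \<in> UNIV \<and> card (fst k) = 0 \<and> card (snd k) = 0. h k) = h ({}, {})"
    by simp
  have "{k :: 'k set \<times> 'l set. k \<in> UNIV \<and> card (fst k) = 1 \<and> card (snd k) = 0} = (\<lambda>i. ({i}, {})) ` UNIV"
    by (auto simp: card_1_singleton_iff)
  then show "(\<Sum>k | k \<in> UNIV \<and> card (fst k) = 1 \<and> card (snd k) = 0. h k) = (\<Sum>i\<in>UNIV. h ({i}, {}))"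
    by (simp add: sum.reindex inj_on_def)
  have "{k :: 'k set \<times> 'l set. k \<in> UNIV \<and> card (snd k) = 1 \<and> card (fst k) = 0} = (\<lambda>j. ({}, {j})) ` UNIV"
    by (auto simp: card_1_singleton_iff)
  then show "(\<Sum>k | k \<in> UNIV \<and> card (snd k) = 1 \<and> card (fst k) = 0. h k) = (\<Sum>j\<in>UNIV. h ({}, {j}))"
    by (simp add: sum.reindex inj_on_def)
  have "{k :: 'k set \<times> 'l set. k \<in> UNIV \<and> card (fst k) = 1 \<and> card (snd k) = 1} = (\<lambda>(i, j). ({i}, {j})) ` UNIV"
    by (force simp: card_1_singleton_iff)
  then show "(\<Sum>k | k \<in> UNIV \<and> card (fst k) = 1 \<and> card (snd k) = 1. h k) = (\<Sum>(i, j)\<in>UNIV. h ({i}, {j}))"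
    by (simp add: sum.reindex inj_on_def case_prod_unfold)
qed

context
  fixes \<psi> :: "complex^(('n::finite \<Rightarrow> 'a::finite) \<times> ('m::finite \<Rightarrow> 'b::finite))" and u v and i :: 'n and j :: 'm
  assumes \<psi>: "\<psi> \<in> tensor_space sym_space sym_space"
    and uv: "norm u = 1" "norm v = 1" "poly_form \<psi> u v \<noteq> 0"
    and max: "\<And>u' v'. cmod (poly_form \<psi> u' v') \<le> cmod (poly_form \<psi> u v) * (norm u' ^ CARD('n) * norm v' ^ CARD('m))"
begin

lemma poly_form_growth:
  assumes "cinner u x = 0" "cinner v y = 0"
  shows "cmod (\<Sum>k\<in>UNIV. s ^ card (fst k) * t ^ card (snd k) * mixed_form \<psi> x u (fst k) y v (snd k)) \<le>
    cmod (poly_form \<psi> u v) * exp (real CARD('n) * (norm x)\<^sup>2 / 2 * (cmod s)\<^sup>2 + real CARD('m) * (norm y)\<^sup>2 / 2 * (cmod t)\<^sup>2)"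
proof -
  have "cmod (\<Sum>k\<in>UNIV. s ^ card (fst k) * t ^ card (snd k) * mixed_form \<psi> x u (fst k) y v (snd k)) =
      cmod (poly_form \<psi> (u + s *s x) (v + t *s y))"
    by (simp add: poly_form_expand case_prod_unfold)
  also have "\<dots> \<le> cmod (poly_form \<psi> u v) * (norm (u + s *s x) ^ CARD('n) * norm (v + t *s y) ^ CARD('m))"
    by (rule max)
  also have "\<dots> \<le> cmod (poly_form \<psi> u v) *
      (exp (real CARD('n) * (norm x)\<^sup>2 / 2 * (cmod s)\<^sup>2) * exp (real CARD('m) * (norm y)\<^sup>2 / 2 * (cmod t)\<^sup>2))"
    by (intro mult_left_mono mult_mono norm_power_orthogonal_le assms uv) auto
  finally show ?thesis
    by (simp add: exp_add)
qed

lemma mixed_form_orthogonal_eq_0: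
  shows "cinner u x = 0 \<Longrightarrow> mixed_form \<psi> x u {i} v v {j} = 0"
    and "cinner v y = 0 \<Longrightarrow> mixed_form \<psi> u u {i} y v {j} = 0"
proof -
  assume x: "cinner u x = 0"
  have "(\<Sum>k | k \<in> UNIV \<and> card (fst k) = 1 \<and> card (snd k) = 0. mixed_form \<psi> x u (fst k) 0 v (snd k)) = 0"
    by (rule first_order_coeff_eq_0[OF _ _ uv(3) poly_form_growth[OF x]])
      (unfold sum_card_1, simp_all add: mixed_form_empty)
  \<comment> \<open>Placing \<open>v\<close> on factor \<open>j\<close> and \<open>v\<close> on the
    rest is placing \<open>v\<close> everywhere, so \<open>{}\<close> on the second side may be
    replaced by \<open>{j}\<close>.\<close>
  moreover have "mixed_form \<psi> x u {k} 0 v {} = mixed_form \<psi> x u {i} v v {j}" for k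
    unfolding mixed_form_singletons(1)[OF \<psi>, of x u k 0 v "{}" i]
    by (simp add: mixed_form_def mixed_prod_same) (simp add: mixed_prod_def)
  ultimately show "mixed_form \<psi> x u {i} v v {j} = 0"
    unfolding sum_card_1 by simp
next
  assume y: "cinner v y = 0"
  have "(\<Sum>k | k \<in> UNIV \<and> card (snd k) = 1 \<and> card (fst k) = 0. mixed_form \<psi> 0 u (fst k) y v (snd k)) = 0"
  proof (rule first_order_coeff_eq_0[OF _ _ uv(3)])
    \<comment> \<open>The first-order lemma treats its first variable, so \<open>s\<close> and
      \<open>t\<close> trade places; the direction \<open>0\<close> in the first factor gives the
      coefficient \<open>0\<close> of \<open>t\<close>.\<close>
    show "cmod (\<Sum>k\<in>UNIV. s ^ card (snd k) * t ^ card (fst k) * mixed_form \<psi> 0 u (fst k) y v (snd k)) \<le>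
      cmod (poly_form \<psi> u v) * exp (real CARD('m) * (norm y)\<^sup>2 / 2 * (cmod s)\<^sup>2 + 0 * (cmod t)\<^sup>2)" for s t
      using poly_form_growth[of 0 y t s] y by (simp add: mult.commute[of "s ^ _"])
    show "(\<Sum>k | k \<in> UNIV \<and> card (snd k) = 0 \<and> card (fst k) = 0. mixed_form \<psi> 0 u (fst k) y v (snd k)) = poly_form \<psi> u v"
      using sum_card_1(1)[of "\<lambda>k. mixed_form \<psi> 0 u (fst k) y v (snd k)"]
      by (simp add: mixed_form_empty conj_commute)
  qed simp
  moreover have "mixed_form \<psi> 0 u {} y v {k} = mixed_form \<psi> u u {i} y v {j}" for k
    unfolding mixed_form_singletons(2)[OF \<psi>, of 0 u "{}" y v k j]
    by (simp add: mixed_form_def mixed_prod_same) (simp add: mixed_prod_def)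
  ultimately show "mixed_form \<psi> u u {i} y v {j} = 0"
    unfolding sum_card_1 by simp
qed

text \<open>The second-order condition: \<open>n m\<close> equal coefficients are set against growth
  of order \<open>n\<close> in \<open>x\<close> and \<open>m\<close> in \<open>y\<close>, which
  leaves \<open>1 / sqrt (n m)\<close>.\<close>

lemma mixed_form_orthogonal_bound:
  assumes x: "cinner u x = 0" and y: "cinner v y = 0"
  shows "cmod (mixed_form \<psi> x u {i} y v {j}) \<le>
    cmod (poly_form \<psi> u v) / sqrt (real CARD('n) * real CARD('m)) * (norm x * norm y)"
proof (cases "x = 0 \<or> y = 0")
  case True
  then show ?thesis
    by (auto simp: mixed_form_def mixed_prod_def)
next
  case False
  let ?n = "real CARD('n)" and ?m = "real CARD('m)" and ?D = "mixed_form \<psi> x u {i} y v {j}"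
  have nm: "?n > 0" "?m > 0" by simp_all
  have sum: "(\<Sum>k | k \<in> UNIV \<and> card (fst k) = 1 \<and> card (snd k) = 1. mixed_form \<psi> x u (fst k) y v (snd k)) =
      of_real (?n * ?m) * ?D"
  proof -
    have "mixed_form \<psi> x u {k} y v {l} = ?D" for k l
      using mixed_form_singletons[OF \<psi>] by metis
    then have "(\<Sum>(k, l)\<in>UNIV. mixed_form \<psi> x u {k} y v {l}) = (\<Sum>_\<in>(UNIV :: ('n \<times> 'm) set). ?D)"
      by (intro sum.cong) auto
    then show ?thesis
      unfolding sum_card_1 by simp
  qed
  \<comment> \<open>These weights make the two terms on the right equal, the optimal case of the
    arithmetic-geometric mean inequality.\<close>
  have "(sqrt ?m * norm y) * (sqrt ?n * norm x) *
      cmod (\<Sum>k | k \<in> UNIV \<and> card (fst k) = 1 \<and> card (snd k) = 1. mixed_form \<psi> x u (fst k) y v (snd k))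
     \<le> cmod (poly_form \<psi> u v) * (?n * (norm x)\<^sup>2 / 2 * (sqrt ?m * norm y)\<^sup>2 + ?m * (norm y)\<^sup>2 / 2 * (sqrt ?n * norm x)\<^sup>2)"
    by (rule mixed_second_order_coeff_bound[OF _ _ uv(3) poly_form_growth[OF x y]])
      (unfold sum_card_1, simp_all add: mixed_form_empty)
  then have "(sqrt ?m * norm y) * (sqrt ?n * norm x) * (?n * ?m * cmod ?D) \<le>
      cmod (poly_form \<psi> u v) * (?n * (norm x)\<^sup>2 / 2 * (sqrt ?m * norm y)\<^sup>2 + ?m * (norm y)\<^sup>2 / 2 * (sqrt ?n * norm x)\<^sup>2)"
    unfolding sum by (simp add: norm_mult)
  also have "\<dots> = (norm x * norm y * ?n * ?m) * (cmod (poly_form \<psi> u v) * (norm x * norm y))"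
    using nm by (simp add: power_mult_distrib) (simp add: power2_eq_square)
  also have "(sqrt ?m * norm y) * (sqrt ?n * norm x) * (?n * ?m * cmod ?D) =
      (norm x * norm y * ?n * ?m) * (sqrt (?n * ?m) * cmod ?D)"
    by (simp add: real_sqrt_mult)
  finally have "sqrt (?n * ?m) * cmod ?D \<le> cmod (poly_form \<psi> u v) * (norm x * norm y)"
    using False nm by (simp add: mult_le_cancel_left_pos)
  then show ?thesis
    using nm by (simp add: field_simps)
qed

end

section \<open>The deviation from a product vector in Frobenius norm\<close>

lemma norm_sq_vec_prod: "(norm (\<xi> :: complex^('a::finite \<times> 'b::finite)))\<^sup>2 = (\<Sum>a\<in>UNIV. \<Sum>b\<in>UNIV. (cmod (\<xi> $ (a, b)))\<^sup>2)"
  by (simp add: norm_vec_def L2_set_def sum_nonneg sum.cartesian_product case_prod_unfold)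

lemma norm_tensor_vec: "norm (tensor_vec u v) = norm u * norm v"
proof -
  have "(norm (tensor_vec u v))\<^sup>2 = (norm u * norm v)\<^sup>2"
    unfolding norm_sq_vec_prod power_mult_distrib
    by (simp add: tensor_vec_def norm_vec_def L2_set_def sum_nonneg norm_mult power_mult_distrib sum_product)
  then show ?thesis by simp
qed

lemma norm_conj_vec: "norm (conj_vec u) = norm (u :: complex^'i::finite)"
  by (simp add: norm_vec_def conj_vec_def)

lemma cinner_axis_left: "cinner (axis a 1) x = x $ a"
proof -
  have "cinner (axis a 1) x = (\<Sum>i\<in>UNIV. if i = a then x $ a else 0)"
    unfolding cinner_def by (intro sum.cong) (auto simp: axis_def)
  then show ?thesis by simp
qed

text \<open>Since \<open>\<xi>\<close> annihilates \<open>u\<close>, its row \<open>a\<close> is its value at the projection of the basis vector \<open>a\<close>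
  onto the complement of \<open>u\<close>; the squared norms of these projections add up to \<open>CARD('a) - 1\<close>.\<close>

lemma frobenius_norm_le:
  fixes \<xi> :: "complex^('a::finite \<times> 'b::finite)"
  assumes u: "norm u = 1" "\<And>y :: complex^'b. (\<Sum>q\<in>UNIV. u $ fst q * y $ snd q * \<xi> $ q) = 0"
    and bound: "\<And>x y. cinner u x = 0 \<Longrightarrow> cmod (\<Sum>q\<in>UNIV. x $ fst q * y $ snd q * \<xi> $ q) \<le> K * (norm x * norm y)"
  shows "(norm \<xi>)\<^sup>2 \<le> K\<^sup>2 * (real CARD('a) - 1)"
proof -
  have row: "(\<Sum>b\<in>UNIV. (cmod (\<xi> $ (a, b)))\<^sup>2) \<le> K\<^sup>2 * (1 - (cmod (u $ a))\<^sup>2)" for a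
  proof -
    \<comment> \<open>Pairing row \<open>a\<close> with its own conjugate gives its squared norm
      \<open>r\<close>. The bound is linear in \<open>norm y\<close>, the root of \<open>r\<close>,
      so it yields \<open>r \<le> K\<^sup>2 * (norm x)\<^sup>2\<close>.\<close>
    define y where "y = (\<chi> b. cnj (\<xi> $ (a, b)))"
    define x where "x = axis a 1 - cnj (u $ a) *s u"
    define r where "r = (\<Sum>b\<in>UNIV. (cmod (\<xi> $ (a, b)))\<^sup>2)"
    have r0: "r \<ge> 0" by (simp add: r_def sum_nonneg)
    have ny: "(norm y)\<^sup>2 = r"
      by (simp add: y_def r_def norm_vec_def L2_set_def sum_nonneg)
    have ua: "cinner u (axis a 1) = cnj (u $ a)"
      by (simp add: cinner_axis_left cinner_commute[of u])
    have ux: "cinner u x = 0"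
      by (simp add: x_def cinner_diff_right cinner_scale_right ua cinner_self u)
    have "cinner x x = cinner (axis a 1) x"
      by (subst (1) x_def) (simp add: cinner_diff_left cinner_scale_left ux)
    also have "\<dots> = 1 - cnj (u $ a) * u $ a"
      unfolding cinner_axis_left by (simp add: x_def axis_def)
    finally have "cinner x x = of_real (1 - (cmod (u $ a))\<^sup>2)"
      by (simp add: complex_norm_square mult.commute del: of_real_power)
    then have nx: "(norm x)\<^sup>2 = 1 - (cmod (u $ a))\<^sup>2"
      unfolding cinner_self of_real_eq_iff .
    have "(\<Sum>q\<in>UNIV. x $ fst q * y $ snd q * \<xi> $ q) =
        (\<Sum>q\<in>UNIV. axis a 1 $ fst q * y $ snd q * \<xi> $ q) - cnj (u $ a) * (\<Sum>q\<in>UNIV. u $ fst q * y $ snd q * \<xi> $ q)"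
      by (simp add: x_def algebra_simps sum_subtractf sum_distrib_left)
    also have "\<dots> = (\<Sum>q\<in>UNIV. axis a 1 $ fst q * y $ snd q * \<xi> $ q)"
      by (simp add: u)
    also have "\<dots> = (\<Sum>a'\<in>UNIV. \<Sum>b\<in>UNIV. axis a 1 $ a' * y $ b * \<xi> $ (a', b))"
      by (simp add: sum.cartesian_product case_prod_unfold)
    also have "\<dots> = (\<Sum>a'\<in>UNIV. if a' = a then (\<Sum>b\<in>UNIV. y $ b * \<xi> $ (a, b)) else 0)"
      by (intro sum.cong) (auto simp: axis_def)
    also have "\<dots> = of_real r"
      by (simp add: y_def r_def complex_norm_square mult.commute del: of_real_power)
    finally have "r \<le> K * (norm x * norm y)"
      using bound[OF ux, of y] r0 by simp
    also have "\<dots> \<le> \<bar>K * norm x\<bar> * norm y"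
      by (simp add: mult_right_mono flip: mult.assoc)
    finally have "r\<^sup>2 \<le> (\<bar>K * norm x\<bar> * norm y)\<^sup>2"
      using r0 by (intro power_mono)
    then have "r * r \<le> (K\<^sup>2 * (norm x)\<^sup>2) * r"
      by (simp add: power_mult_distrib ny) (simp add: power2_eq_square)
    then have "r \<le> K\<^sup>2 * (norm x)\<^sup>2"
      using r0 by (cases "r = 0") (auto simp: mult_le_cancel_right)
    then show ?thesis
      by (simp add: r_def nx)
  qed
  have "(\<Sum>a\<in>UNIV. (cmod (u $ a))\<^sup>2) = 1"
    using u(1) by (simp add: norm_vec_def L2_set_def)
  moreover have "(norm \<xi>)\<^sup>2 \<le> (\<Sum>a\<in>UNIV. K\<^sup>2 * (1 - (cmod (u $ a))\<^sup>2))"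
    unfolding norm_sq_vec_prod by (intro sum_mono row)
  ultimately show ?thesis
    by (simp add: sum_subtractf flip: sum_distrib_left)
qed

lemma orthogonal_decomposition:
  assumes "norm u = 1"
  obtains x' where "x = cinner u x *s u + x'" "cinner u x' = 0" "norm x' \<le> norm x"
proof -
  define x' where "x' = x - cinner u x *s u"
  have x: "x = x' + cinner u x *s u"
    by (simp add: x'_def)
  have o: "cinner u x' = 0"
    by (simp add: x'_def cinner_diff_right cinner_scale_right cinner_self assms)
  then have "cinner x' u = 0"
    by (metis cinner_commute complex_cnj_zero)
  then have "(norm x)\<^sup>2 = (norm x')\<^sup>2 + (cmod (cinner u x))\<^sup>2 * (norm u)\<^sup>2"
    by (subst x) (rule norm_sq_orthogonal)
  then have "(norm x')\<^sup>2 \<le> (norm x)\<^sup>2" by simp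
  then have "norm x' \<le> norm x"
    by (rule power2_le_imp_le) simp
  with x o that show thesis
    by (metis add.commute)
qed

text \<open>As a bilinear form \<open>B\<close>, the remainder is the mixed form divided by
  \<open>G\<close> minus the product of the overlaps with \<open>u\<close> and \<open>v\<close>. On
  the complements of \<open>u\<close> and \<open>v\<close> only the mixed form is left, and its
  bound passes to all vectors because \<open>B\<close> annihilates \<open>u\<close> and
  \<open>v\<close>.\<close>

lemma contract_near_product:
  fixes \<psi> :: "complex^(('n::finite \<Rightarrow> 'a::finite) \<times> ('m::finite \<Rightarrow> 'b::finite))" and i :: 'n and j :: 'm
  assumes \<psi>: "\<psi> \<in> tensor_space sym_space sym_space"
    and uv: "norm u = 1" "norm v = 1" "poly_form \<psi> u v \<noteq> 0"
    and max: "\<And>u' v'. cmod (poly_form \<psi> u' v') \<le> cmod (poly_form \<psi> u v) * (norm u' ^ CARD('n) * norm v' ^ CARD('m))"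
  obtains \<xi> where "contract i j \<psi> u v = poly_form \<psi> u v *s (tensor_vec (conj_vec u) (conj_vec v) + \<xi>)"
    "norm \<xi> \<le> sqrt ((real (min CARD('a) CARD('b)) - 1) / (real CARD('n) * real CARD('m)))"
proof -
  define G where "G = poly_form \<psi> u v"
  define K where "K = 1 / sqrt (real CARD('n) * real CARD('m))"
  define \<xi> where "\<xi> = (1 / G) *s contract i j \<psi> u v - tensor_vec (conj_vec u) (conj_vec v)"
  define B where "B x y = (\<Sum>q\<in>UNIV. x $ fst q * y $ snd q * \<xi> $ q)" for x y
  have G: "G \<noteq> 0" using uv by (simp add: G_def)
  have K: "K \<ge> 0" by (simp add: K_def)
  have BM: "B x y = mixed_form \<psi> x u {i} y v {j} / G - cinner u x * cinner v y" for x y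
  proof -
    have "B x y = (1 / G) * (\<Sum>q\<in>UNIV. x $ fst q * y $ snd q * contract i j \<psi> u v $ q) -
        (\<Sum>q\<in>UNIV. (cnj (u $ fst q) * x $ fst q) * (cnj (v $ snd q) * y $ snd q))"
      unfolding B_def \<xi>_def
      by (simp add: tensor_vec_def conj_vec_def algebra_simps sum_subtractf sum_distrib_left)
    also have "(\<Sum>q\<in>UNIV. (cnj (u $ fst q) * x $ fst q) * (cnj (v $ snd q) * y $ snd q)) = cinner u x * cinner v y"
      unfolding cinner_def sum_product by (simp add: sum.cartesian_product case_prod_unfold)
    finally show ?thesis
      by (simp add: contract_mixed_form)
  qed
  have Badd1: "B (c *s x + x') y = c * B x y + B x' y" for c x x' y
    by (simp add: B_def algebra_simps sum.distrib sum_distrib_left)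
  have Badd2: "B x (c *s y + y') = c * B x y + B x y'" for c x y y'
    by (simp add: B_def algebra_simps sum.distrib sum_distrib_left)
  have Buv: "B u v = 0"
    unfolding BM using G by (simp add: mixed_form_def mixed_prod_same poly_form_def G_def cinner_self uv)
  have Bxv: "B x v = 0" for x
  proof -
    obtain x' where x': "x = cinner u x *s u + x'" "cinner u x' = 0"
      using orthogonal_decomposition[OF uv(1)] by metis
    have "B x' v = 0"
      unfolding BM by (simp add: mixed_form_orthogonal_eq_0(1)[OF \<psi> uv max x'(2)] x'(2))
    then show ?thesis
      by (subst x'(1)) (simp add: Badd1 Buv)
  qed
  have Buy: "B u y = 0" for y
  proof -
    obtain y' where y': "y = cinner v y *s v + y'" "cinner v y' = 0"
      using orthogonal_decomposition[OF uv(2)] by metis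
    have "B u y' = 0"
      unfolding BM by (simp add: mixed_form_orthogonal_eq_0(2)[OF \<psi> uv max y'(2)] y'(2))
    then show ?thesis
      by (subst y'(1)) (simp add: Badd2 Buv)
  qed
  have Bbound: "cmod (B x y) \<le> K * (norm x * norm y)" for x y
  proof -
    obtain x' where x': "x = cinner u x *s u + x'" "cinner u x' = 0" "norm x' \<le> norm x"
      using orthogonal_decomposition[OF uv(1)] by metis
    obtain y' where y': "y = cinner v y *s v + y'" "cinner v y' = 0" "norm y' \<le> norm y"
      using orthogonal_decomposition[OF uv(2)] by metis
    have "B x y = B x' y'"
      by (subst x'(1), subst y'(1)) (simp add: Badd1 Badd2 Bxv Buy)
    also have "cmod \<dots> = cmod (mixed_form \<psi> x' u {i} y' v {j}) / cmod G"
      unfolding BM by (simp add: x' norm_divide)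
    also have "\<dots> \<le> K * (norm x' * norm y')"
      using mixed_form_orthogonal_bound[OF \<psi> uv max x'(2) y'(2), of i j] G
      by (simp add: K_def G_def[symmetric] field_simps)
    also have "\<dots> \<le> K * (norm x * norm y)"
      by (intro mult_left_mono mult_mono x' y' K) auto
    finally show ?thesis .
  qed
  have nA: "(norm \<xi>)\<^sup>2 \<le> K\<^sup>2 * (real CARD('a) - 1)"
    using Buy Bbound by (intro frobenius_norm_le[OF uv(1)]) (simp_all add: B_def)
  have nB: "(norm \<xi>)\<^sup>2 \<le> K\<^sup>2 * (real CARD('b) - 1)"
  proof -
    \<comment> \<open>Exchanging the two factors turns the row estimate into a column estimate, with
      \<open>CARD('b)\<close> in place of \<open>CARD('a)\<close>.\<close>
    define \<xi>' where "\<xi>' = (\<chi> q. \<xi> $ (snd q, fst q))"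
    have swap: "(\<Sum>q\<in>UNIV. y $ fst q * x $ snd q * \<xi>' $ q) = B x y" for x y
      unfolding B_def \<xi>'_def
      by (rule sum.reindex_bij_witness[of _ "\<lambda>q. (snd q, fst q)" "\<lambda>q. (snd q, fst q)"]) auto
    have "(norm \<xi>')\<^sup>2 \<le> K\<^sup>2 * (real CARD('b) - 1)"
    proof (rule frobenius_norm_le[OF uv(2)])
      show "cmod (\<Sum>q\<in>UNIV. y $ fst q * x $ snd q * \<xi>' $ q) \<le> K * (norm y * norm x)" for x y
        unfolding swap using Bbound[of x y] by (simp add: mult.commute)
    qed (simp add: swap Bxv)
    moreover have "norm \<xi>' = norm \<xi>"
      unfolding norm_vec_def L2_set_def \<xi>'_def
      by (intro arg_cong[where f = sqrt] sum.reindex_bij_witness[of _ "\<lambda>q. (snd q, fst q)" "\<lambda>q. (snd q, fst q)"]) auto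
    ultimately show ?thesis by simp
  qed
  have "(norm \<xi>)\<^sup>2 \<le> K\<^sup>2 * (real (min CARD('a) CARD('b)) - 1)"
    using nA nB by (simp add: min_def)
  then have "norm \<xi> \<le> sqrt (K\<^sup>2 * (real (min CARD('a) CARD('b)) - 1))"
    by (rule real_le_rsqrt)
  then have "norm \<xi> \<le> sqrt ((real (min CARD('a) CARD('b)) - 1) / (real CARD('n) * real CARD('m)))"
    by (simp add: K_def power_divide)
  moreover have "contract i j \<psi> u v = poly_form \<psi> u v *s (tensor_vec (conj_vec u) (conj_vec v) + \<xi>)"
    using G by (simp add: \<xi>_def G_def[symmetric] vec_eq_iff)
  ultimately show thesis
    using that by blast
qed

section \<open>From one observable to the distance from the separable set\<close>

text \<open>Provides the witnesses for \<open>separable_approximation\<close>. The extension is a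
  mixture of eigenvectors in the symmetric subspace, so the maximum \<open>lam\<close> of the
  quadratic form there dominates the value on the marginal.\<close>

lemma marginal_le_product_value:
  fixes \<rho> :: "(('n::finite \<Rightarrow> 'a::finite) \<times> ('m::finite \<Rightarrow> 'b::finite)) operator" and i :: 'n and j :: 'm
  assumes \<rho>: "density_operator \<rho>" "supported_on \<rho> (tensor_space sym_space sym_space)"
    and Y: "adj Y = Y" "\<And>x. norm (Y *v x) \<le> t * norm x"
  obtains u v where "norm u = 1" "norm v = 1"
    "Y \<bullet> marginal i j \<rho> \<le> tensor_vec u v \<bullet> (Y *v tensor_vec u v) +
      t * sqrt ((real (min CARD('a) CARD('b)) - 1) / (real CARD('n) * real CARD('m)))"
proof -
  define S :: "(complex^(('n \<Rightarrow> 'a) \<times> ('m \<Rightarrow> 'b))) set" where "S = tensor_space sym_space sym_space"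
  define L where "L = local_op i j Y"
  have cS: "vec.subspace S"
    by (simp add: S_def tensor_space_def)
  have adjL: "adj L = L"
    by (simp add: L_def adj_local_op Y)
  have "adj \<rho> = \<rho>"
    using \<rho> by (simp add: density_operator_def psd_def)
  then obtain E l where E: "eigenbasis \<rho> E l"
    by (rule hermitian_eigenbasis)
  note \<rho>E = spectral_decomposition[OF E]
  have l0: "l e \<ge> 0" if "e \<in> E" for e
  proof -
    have "0 \<le> e \<bullet> (\<rho> *v e)"
      using \<rho> by (simp add: density_operator_def psd_def inner_eq_Re_cinner)
    then show ?thesis
      using that eigenbasisD(2,3)[OF E] by (simp add: dot_square_norm flip: scaleR_eq_of_real_smult)
  qed
  have l1: "(\<Sum>e\<in>E. l e) = 1"
  proof -
    have "trace (spectral_op E l) = 1"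
      using \<rho> by (simp add: density_operator_def flip: \<rho>E)
    then show ?thesis
      unfolding trace_spectral_op[OF E] of_real_eq_1_iff .
  qed
  have ES: "e \<in> S" if "e \<in> E" "l e \<noteq> 0" for e
  proof -
    have "\<rho> *v (of_real (1 / l e) *s e) = e"
      unfolding vector_scalar_commute eigenbasisD(3)[OF E that(1)] vector_smult_assoc
      using that(2) by (simp flip: of_real_mult)
    then show ?thesis
      using \<rho>(2) unfolding supported_on_def S_def by (metis rangeI subsetD)
  qed
  obtain e where "e \<in> E" "l e \<noteq> 0"
    using l1 by (metis sum.neutral zero_neq_one)
  then have ne: "S \<noteq> {0}"
    using ES eigenbasisD(2)[OF E] by force
  obtain \<psi> lam where \<psi>: "\<psi> \<in> S" "norm \<psi> = 1"
    and lam_max: "\<And>x. x \<in> S \<Longrightarrow> x \<bullet> (L *v x) \<le> lam * (x \<bullet> x)"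
    and lam_eq: "\<And>x. x \<in> S \<Longrightarrow> x \<bullet> (L *v \<psi>) = lam * (x \<bullet> \<psi>)"
    using rayleigh_maximizer[OF complex_subspace_imp_subspace[OF cS] ne linear_matrix_vector_mult_complex
        hermitian_inner[OF adjL]] by blast
  have "Y \<bullet> marginal i j \<rho> = (\<Sum>e\<in>E. l e * (e \<bullet> (L *v e)))"
    unfolding inner_marginal L_def[symmetric]
    by (subst \<rho>E) (simp add: spectral_op_def inner_sum_right inner_rank_one)
  also have "\<dots> \<le> (\<Sum>e\<in>E. l e * lam)"
  proof (rule sum_mono)
    fix e assume e: "e \<in> E"
    show "l e * (e \<bullet> (L *v e)) \<le> l e * lam"
    proof (cases "l e = 0")
      case False
      with e lam_max[OF ES] eigenbasisD(2)[OF E] l0 show ?thesis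
        by (intro mult_left_mono) (auto simp: dot_square_norm)
    qed simp
  qed
  also have "\<dots> = lam"
    by (simp add: l1 flip: sum_distrib_right)
  finally have le_lam: "Y \<bullet> marginal i j \<rho> \<le> lam" .
  have \<psi>S: "\<psi> \<in> tensor_space sym_space sym_space" "\<psi> \<noteq> 0"
    using \<psi> by (auto simp: S_def)
  obtain u v where uv: "norm u = 1" "norm v = 1" "poly_form \<psi> u v \<noteq> 0"
    and max: "\<And>u' v'. cmod (poly_form \<psi> u' v') \<le> cmod (poly_form \<psi> u v) * (norm u' ^ CARD('n) * norm v' ^ CARD('m))"
    by (rule poly_form_maximizer[OF \<psi>S]) blast
  obtain \<xi> where \<xi>: "contract i j \<psi> u v = poly_form \<psi> u v *s (tensor_vec (conj_vec u) (conj_vec v) + \<xi>)"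
    "norm \<xi> \<le> sqrt ((real (min CARD('a) CARD('b)) - 1) / (real CARD('n) * real CARD('m)))"
    by (rule contract_near_product[OF \<psi>S(1) uv max])
  let ?w = "tensor_vec (conj_vec u) (conj_vec v)"
  let ?x = "tensor_vec (tensor_power (conj_vec u)) (tensor_power (conj_vec v)) :: complex^(('n \<Rightarrow> 'a) \<times> ('m \<Rightarrow> 'b))"
  \<comment> \<open>\<open>L\<close> may lead out of \<open>S\<close>, so \<open>\<psi>\<close>
    satisfies the eigenvalue equation only against vectors of \<open>S\<close>; the product of
    tensor powers is one of them.\<close>
  have "cinner ?x (L *v \<psi> - of_real lam *s \<psi>) = 0"
  proof (rule Re_cinner_eq_imp_eq[OF cS])
    show "?x \<in> S"
      by (simp add: S_def tensor_powers_in_tensor_space)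
    show "Re (cinner x (L *v \<psi> - of_real lam *s \<psi>)) = 0" if "x \<in> S" for x
      using lam_eq[OF that] by (simp add: cinner_diff_right cinner_scale_right inner_eq_Re_cinner)
  qed
  then have "cinner ?x (L *v \<psi>) = of_real lam * poly_form \<psi> u v"
    by (simp add: cinner_diff_right cinner_scale_right cinner_tensor_power)
  moreover have "cinner ?x (L *v \<psi>) = poly_form \<psi> u v * cinner (Y *v ?w) (?w + \<xi>)"
    unfolding L_def cinner_tensor_power_local_op[OF Y(1)] \<xi>(1) cinner_scale_right ..
  ultimately have "of_real lam = cinner (Y *v ?w) (?w + \<xi>)"
    using uv(3) by (simp add: mult.commute)
  then have "lam = (Y *v ?w) \<bullet> ?w + (Y *v ?w) \<bullet> \<xi>"
    unfolding inner_eq_Re_cinner cinner_add_right by (metis Re_complex_of_real plus_complex.sel(1))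
  also have "\<dots> \<le> ?w \<bullet> (Y *v ?w) + norm (Y *v ?w) * norm \<xi>"
    using norm_cauchy_schwarz[of "Y *v ?w" \<xi>] by (simp add: inner_commute)
  also have "norm (Y *v ?w) * norm \<xi> \<le> t * sqrt ((real (min CARD('a) CARD('b)) - 1) / (real CARD('n) * real CARD('m)))"
  proof (rule mult_mono)
    show "norm (Y *v ?w) \<le> t"
      using Y(2)[of ?w] by (simp add: norm_tensor_vec norm_conj_vec uv)
    then show "0 \<le> t"
      by (rule order_trans[OF norm_ge_zero])
  qed (use \<xi> in auto)
  finally show thesis
    using that[of "conj_vec u" "conj_vec v"] le_lam uv by (simp add: norm_conj_vec)
qed

theorem theorem1p4:
  fixes i :: "'n::finite" and j :: "'m::finite"
  shows "(SUP \<rho> \<in> (BEXT i j :: ('a::finite \<times> 'b::finite) operator set).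
            INF \<sigma> \<in> SEP. ereal (1 / 2 * trace_norm (\<rho> - \<sigma>)))
          \<le> ereal (1 / 2 * sqrt ((real (min CARD('a) CARD('b)) - 1)
                                  / (real CARD('n) * real CARD('m))))"
proof (rule SUP_least)
  let ?\<delta> = "sqrt ((real (min CARD('a) CARD('b)) - 1) / (real CARD('n) * real CARD('m)))"
  fix \<rho> :: "('a \<times> 'b) operator"
  assume "\<rho> \<in> BEXT i j"
  then obtain \<tau> :: "(('n \<Rightarrow> 'a) \<times> ('m \<Rightarrow> 'b)) operator" where \<tau>: "density_operator \<tau>"
    "supported_on \<tau> (tensor_space sym_space sym_space)" "\<rho> = marginal i j \<tau>"
    unfolding BEXT_def by blast
  show "(INF \<sigma> \<in> SEP. ereal (1 / 2 * trace_norm (\<rho> - \<sigma>))) \<le> ereal (1 / 2 * ?\<delta>)"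
  proof (rule ereal_le_epsilon2)
    \<comment> \<open>\<open>separable_approximation\<close> asks for a positive radius, but
      \<open>?\<delta>\<close> is \<open>0\<close> when a local dimension is \<open>1\<close>; hence
      the slack \<open>\<epsilon>\<close>.\<close>
    fix \<epsilon> :: real assume \<epsilon>: "\<epsilon> > 0"
    have "min CARD('a) CARD('b) \<ge> 1"
      by (simp add: Suc_leI)
    then have \<delta>0: "?\<delta> \<ge> 0"
      by simp
    have "adj \<rho> = \<rho>"
      using \<tau> by (simp add: adj_marginal density_operator_def psd_def)
    moreover have "?\<delta> + \<epsilon> > 0"
      using \<delta>0 \<epsilon> by linarith
    moreover have "\<exists>u v. norm u = 1 \<and> norm v = 1 \<and>
        Y \<bullet> \<rho> \<le> tensor_vec u v \<bullet> (Y *v tensor_vec u v) + t * (?\<delta> + \<epsilon>)"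
      if Y: "adj Y = Y" "\<And>x. norm (Y *v x) \<le> t * norm x" for Y :: "('a \<times> 'b) operator" and t
    proof -
      obtain u v where uv: "norm u = 1" "norm v = 1"
        "Y \<bullet> \<rho> \<le> tensor_vec u v \<bullet> (Y *v tensor_vec u v) + t * ?\<delta>"
        using marginal_le_product_value[OF \<tau>(1,2) Y] \<tau>(3) by blast
      have "0 \<le> t"
        using order_trans[OF norm_ge_zero Y(2)[of "tensor_vec u v"]] uv by (simp add: norm_tensor_vec)
      with \<epsilon> have "t * ?\<delta> \<le> t * (?\<delta> + \<epsilon>)"
        by (intro mult_left_mono) auto
      with uv show ?thesis
        by (meson add_left_mono order_trans)
    qed
    ultimately obtain \<sigma> where \<sigma>: "\<sigma> \<in> SEP" "trace_norm (\<rho> - \<sigma>) \<le> ?\<delta> + \<epsilon>"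
      by (rule separable_approximation)
    have "(INF \<sigma> \<in> SEP. ereal (1 / 2 * trace_norm (\<rho> - \<sigma>))) \<le> ereal (1 / 2 * trace_norm (\<rho> - \<sigma>))"
      using \<sigma>(1) by (rule INF_lower)
    also have "\<dots> \<le> ereal (1 / 2 * ?\<delta> + \<epsilon>)"
      using \<sigma>(2) \<epsilon> by simp
    finally show "(INF \<sigma> \<in> SEP. ereal (1 / 2 * trace_norm (\<rho> - \<sigma>))) \<le> ereal (1 / 2 * ?\<delta>) + ereal \<epsilon>"
      by simp
  qed
qed

end
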